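(* Assume Hypothesis (H) and fix $t_0\in(\alpha,\beta)$. Suppose $\lambda_{t_0}$ is a simple eigenvalue of $H_{t_0}$ with normalized eigenfunction $u_{t_0}$, and let $t\mapsto\lambda_t$ be the (differentiable) eigenvalue curve of $H_t$ through $\lambda_{t_0}$. Let $\mathcal K_{\lambda}:=\{(\gamma_Df,\gamma_Nf): f\in\widehat H^2(\Gamma),\ -f''+qf=\lambda f\}$. Then $$\frac{d\lambda_t}{dt}\Big|_{t=t_0}=\big\langle (A_{t_0}\dot B_{t_0}^*-B_{t_0}\dot A_{t_0}^* )\phi_{t_0},\phi_{t_0}\big\rangle_{\mathbb C^{2|\mathcal E|}}=\mathfrak m_{t_0,\mathcal K_{\lambda_{t_0}}}(\operatorname{Tr}u_{t_0},\operatorname{Tr}u_{t_0}),$$ where $\phi_{t_0}:=(A_{t_0}A_{t_0}^*-B_{t_0}B_{t_0}^* )^{-1}(B_{t_0}\gamma_Du_{t_0}+A_{t_0}\gamma_Nu_{t_0})$ (the matrix $A_{t_0}A_{t_0}^*-B_{t_0}B_{t_0}^*$ being invertible) and a dot denotes the derivative in $t$.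
   Context: Let $\Gamma$ be a compact metric graph with finitely many vertices and a finite edge set $\mathcal E$; each edge $e$ is identified with an interval $[a_e,b_e]$ of positive length. Let $\partial\Gamma$ be the $2|\mathcal E|$ edge endpoints (counted per edge), $L^2(\partial\Gamma)\cong\mathbb C^{2|\mathcal E|}$, $L^2(\Gamma)=\bigoplus_eL^2(e)$, $\widehat H^2(\Gamma)=\bigoplus_eH^2(e)$. For $f\in\widehat H^2(\Gamma)$, $\gamma_Df$ is the vector of endpoint values and $\gamma_Nf$ the vector of endpoint derivatives taken in the direction pointing into the edge; $\operatorname{Tr}f:=(\gamma_Df,\gamma_Nf)$. Symplectic form on $\mathbb C^{2|\mathcal E|}\oplus\mathbb C^{2|\mathcal E|}$: $\omega((\phi_1,\phi_2),(\psi_1,\psi_2)):=\sum_{p\in\partial\Gamma}(\phi_2(p)\overline{\psi_1(p)}-\phi_1(p)\overline{\psi_2(p)})$; Lagrangian subspaces are those equal to their $\omega$-annihilator. Fix $q\in L^\infty(\Gamma;\mathbb R)$. Hypothesis (H): $t\mapsto(A_t,B_t)$ is $C^1$ on $[\alpha,\beta]$ with values in pairs of complex $2|\mathcal E|\times2|\mathcal E|$ matrices, $\operatorname{rank}(A_t\ B_t)=2|\mathcal E|$, $A_tB_t^*=B_tA_t^*$. $\mathcal L_t:=\{(\phi,\psi):A_t\phi+B_t\psi=0\}=\{(-B_t^*g,A_t^*g):g\in\mathbb C^{2|\mathcal E|}\}$ (Lagrangian). $H_t:=-\frac{d^2}{dx^2}+q$ with domain $\{f\in\widehat H^2(\Gamma):A_t\gamma_Df+B_t\gamma_Nf=0\}$,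 self-adjoint in $L^2(\Gamma)$. Crossing form: since $t\mapsto\mathcal L_t$ is $C^1$, near $t_0$ there are operators $R_t:\mathcal L_{t_0}\to\mathcal L_{t_0}^\perp$, $C^1$ in $t$, $R_{t_0}=0$, with $\mathcal L_t=\{v+R_tv:v\in\mathcal L_{t_0}\}$. For a Lagrangian plane $\mathcal K$ with $\mathcal K\cap\mathcal L_{t_0}\ne\{0\}$, the crossing form of the pair of paths ($\mathcal K$ constant, $\mathcal L_t$) at $t_0$ is $\mathfrak m_{t_0,\mathcal K}(v,v):=-\frac{d}{dt}\omega(v,R_tv)\big|_{t=t_0}=-\omega(v,\dot R_{t_0}v)$ for $v\in\mathcal K\cap\mathcal L_{t_0}$.
   Formalization: Invertibility of A_{t_0}A_{t_0}^*-B_{t_0}B_{t_0}^* is assumed rather than asserted: it does not follow from (H) (for A_t=B_t=I on one edge the matrix is 0 and φ_{t_0} is undefined). *)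

theory Defs
  imports "HOL-Analysis.Analysis"
begin

(* Edges: a finite type 'e. Edge e is the interval [a e, b e].
   Endpoints (boundary \<partial>\<Gamma>): 'e \<times> bool, (e,False) = a e, (e,True) = b e.
   C^{2|E|} = complex ^ ('e \<times> bool). *)

type_synonym ('p) bvec = "complex ^ 'p"
type_synonym ('p) bpair = "(complex ^ 'p) \<times> (complex ^ 'p)"

definition cinner :: "complex ^ 'p \<Rightarrow> complex ^ 'p \<Rightarrow> complex" where
  "cinner x y = (\<Sum>i\<in>UNIV. x $ i * cnj (y $ i))"

definition adj :: "complex ^ 'n ^ 'm \<Rightarrow> complex ^ 'm ^ 'n" where
  "adj A = (\<chi> i j. cnj (A $ j $ i))"

definition hcat :: "complex ^ 'n ^ 'm \<Rightarrow> complex ^ 'n ^ 'm \<Rightarrow> complex ^ ('n + 'n) ^ 'm" where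
  "hcat A B = (\<chi> i j. case j of Inl k \<Rightarrow> A $ i $ k | Inr k \<Rightarrow> B $ i $ k)"

definition omega :: "'p::finite bpair \<Rightarrow> 'p bpair \<Rightarrow> complex" where
  "omega v w = (\<Sum>p\<in>UNIV. snd v $ p * cnj (fst w $ p) - fst v $ p * cnj (snd w $ p))"

definition pinner :: "'p::finite bpair \<Rightarrow> 'p bpair \<Rightarrow> complex" where
  "pinner v w = cinner (fst v) (fst w) + cinner (snd v) (snd w)"

definition perp :: "'p::finite bpair set \<Rightarrow> 'p bpair set" where
  "perp L = {w. \<forall>v\<in>L. pinner v w = 0}"

definition pscale :: "complex \<Rightarrow> 'p::finite bpair \<Rightarrow> 'p bpair" where
  "pscale c v = (c *s fst v, c *s snd v)"

definition bc_plane :: "complex ^ 'p ^ 'p \<Rightarrow> complex ^ 'p ^ 'p \<Rightarrow> 'p::finite bpair set" where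
  "bc_plane A B = {(\<phi>, \<psi>). A *v \<phi> + B *v \<psi> = 0}"

definition graph_rep :: "(real \<Rightarrow> 'p::finite bpair set) \<Rightarrow> real \<Rightarrow> (real \<Rightarrow> 'p bpair \<Rightarrow> 'p bpair) \<Rightarrow> bool" where
  "graph_rep L t0 R \<longleftrightarrow>
     (\<forall>v\<in>L t0. R t0 v = 0) \<and>
     (\<exists>\<epsilon>>0.
        (\<forall>t\<in>ball t0 \<epsilon>.
           (\<forall>v\<in>L t0. R t v \<in> perp (L t0)) \<and>
           (\<forall>v\<in>L t0. \<forall>w\<in>L t0. R t (v + w) = R t v + R t w) \<and>
           (\<forall>v\<in>L t0. \<forall>c. R t (pscale c v) = pscale c (R t v)) \<and>
           L t = {v + R t v | v. v \<in> L t0}) \<and>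
        (\<forall>v\<in>L t0. (\<lambda>t. R t v) differentiable_on ball t0 \<epsilon> \<and>
           continuous_on (ball t0 \<epsilon>) (\<lambda>t. vector_derivative (\<lambda>s. R s v) (at t))))"

(* crossing form of the pair (K constant, L_t) at t0, evaluated on the diagonal (v,v) *)
definition crossing_form :: "'p::finite bpair set \<Rightarrow> (real \<Rightarrow> 'p bpair set) \<Rightarrow> real \<Rightarrow> 'p bpair \<Rightarrow> complex" where
  "crossing_form K L t0 v =
     (if v \<in> K \<inter> L t0 then
        (let R = (SOME R. graph_rep L t0 R)
         in - omega v (vector_derivative (\<lambda>t. R t v) (at t0)))
      else 0)"

(* f \<in> H^2(a,b) with weak second derivative g *)
definition H2_edge :: "real \<Rightarrow> real \<Rightarrow> (real \<Rightarrow> complex) \<Rightarrow> (real \<Rightarrow> complex) \<Rightarrow> bool" where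
  "H2_edge a b f g \<longleftrightarrow>
     set_borel_measurable lborel {a..b} g \<and>
     set_integrable lborel {a..b} g \<and>
     set_integrable lborel {a..b} (\<lambda>x. (cmod (g x))\<^sup>2) \<and>
     (\<exists>f1. (\<forall>x\<in>{a..b}. (f has_vector_derivative f1 x) (at x within {a..b})) \<and>
           (\<forall>x\<in>{a..b}. f1 x = f1 a + (LINT y:{a..x}|lborel. g y)))"

definition solves_eq :: "('e \<Rightarrow> real) \<Rightarrow> ('e \<Rightarrow> real) \<Rightarrow> ('e \<Rightarrow> real \<Rightarrow> real) \<Rightarrow> real
     \<Rightarrow> ('e \<Rightarrow> real \<Rightarrow> complex) \<Rightarrow> bool" where
  "solves_eq a b q \<mu> f \<longleftrightarrow>
     (\<forall>e. \<exists>g. H2_edge (a e) (b e) (f e) g \<and>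
        (AE x in lborel. x \<in> {a e..b e} \<longrightarrow> - g x + complex_of_real (q e x) * f e x = complex_of_real \<mu> * f e x))"

definition gammaD :: "('e \<Rightarrow> real) \<Rightarrow> ('e \<Rightarrow> real) \<Rightarrow> ('e \<Rightarrow> real \<Rightarrow> complex) \<Rightarrow> complex ^ ('e::finite \<times> bool)" where
  "gammaD a b f = (\<chi> p. case p of (e, s) \<Rightarrow> if s then f e (b e) else f e (a e))"

(* derivatives taken in the direction pointing into the edge *)
definition gammaN :: "('e \<Rightarrow> real) \<Rightarrow> ('e \<Rightarrow> real) \<Rightarrow> ('e \<Rightarrow> real \<Rightarrow> complex) \<Rightarrow> complex ^ ('e::finite \<times> bool)" where
  "gammaN a b f = (\<chi> p. case p of (e, s) \<Rightarrow>
      if s then - vector_derivative (f e) (at (b e) within {a e..b e})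
      else vector_derivative (f e) (at (a e) within {a e..b e}))"

definition Tr :: "('e \<Rightarrow> real) \<Rightarrow> ('e \<Rightarrow> real) \<Rightarrow> ('e \<Rightarrow> real \<Rightarrow> complex) \<Rightarrow> ('e::finite \<times> bool) bpair" where
  "Tr a b f = (gammaD a b f, gammaN a b f)"

definition L2norm_sq :: "('e::finite \<Rightarrow> real) \<Rightarrow> ('e \<Rightarrow> real) \<Rightarrow> ('e \<Rightarrow> real \<Rightarrow> complex) \<Rightarrow> real" where
  "L2norm_sq a b f = (\<Sum>e\<in>UNIV. LINT x:{a e..b e}|lborel. (cmod (f e x))\<^sup>2)"

definition in_eigenspace :: "('e \<Rightarrow> real) \<Rightarrow> ('e \<Rightarrow> real) \<Rightarrow> ('e \<Rightarrow> real \<Rightarrow> real)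
     \<Rightarrow> complex ^ ('e::finite \<times> bool) ^ ('e \<times> bool) \<Rightarrow> complex ^ ('e \<times> bool) ^ ('e \<times> bool)
     \<Rightarrow> real \<Rightarrow> ('e \<Rightarrow> real \<Rightarrow> complex) \<Rightarrow> bool" where
  "in_eigenspace a b q A B \<mu> f \<longleftrightarrow>
     solves_eq a b q \<mu> f \<and> A *v gammaD a b f + B *v gammaN a b f = 0"

definition eigenfunction where
  "eigenfunction a b q A B \<mu> f \<longleftrightarrow> in_eigenspace a b q A B \<mu> f \<and> L2norm_sq a b f \<noteq> 0"

definition is_eigenvalue where
  "is_eigenvalue a b q A B \<mu> \<longleftrightarrow> (\<exists>f. eigenfunction a b q A B \<mu> f)"

definition simple_eigenvalue where
  "simple_eigenvalue a b q A B \<mu> \<longleftrightarrow>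
     (\<exists>u. eigenfunction a b q A B \<mu> u \<and>
        (\<forall>f. in_eigenspace a b q A B \<mu> f \<longrightarrow>
           (\<exists>c::complex. \<forall>e. \<forall>x\<in>{a e..b e}. f e x = c * u e x)))"

definition Kset :: "('e::finite \<Rightarrow> real) \<Rightarrow> ('e \<Rightarrow> real) \<Rightarrow> ('e \<Rightarrow> real \<Rightarrow> real) \<Rightarrow> real
     \<Rightarrow> ('e \<times> bool) bpair set" where
  "Kset a b q \<mu> = {Tr a b f | f. solves_eq a b q \<mu> f}"

end

theory Submission
  imports Defs
begin

text \<open>
  Points of the plane at \<open>t\<close> are \<open>(-B\<^sub>t\<^sup>* g, A\<^sub>t\<^sup>* g)\<close>. Writing \<open>Tr u = (-B\<^sub>0\<^sup>* \<phi>, A\<^sub>0\<^sup>* \<phi>)\<close> and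
  \<open>Tr u\<^sub>t = (-B\<^sub>t\<^sup>* g\<^sub>t, A\<^sub>t\<^sup>* g\<^sub>t)\<close> for an eigenfunction \<open>u\<^sub>t\<close> at \<open>\<lambda>\<^sub>t\<close>, Green's identity reads
  \<open>(\<lambda>\<^sub>0 - \<lambda>\<^sub>t) \<langle>u, u\<^sub>t\<rangle> = \<omega>(Tr u, Tr u\<^sub>t) = \<langle>(A\<^sub>t B\<^sub>0\<^sup>* - B\<^sub>t A\<^sub>0\<^sup>*) \<phi>, g\<^sub>t\<rangle>\<close>,
  and the matrix on the right vanishes at the base point. Eigenfunctions normalised by their initial
  data are precompact by Gronwall's inequality, and since the eigenvalue is simple every limit point
  is a nonzero multiple \<open>c u\<close>, with \<open>g\<^sub>t \<rightarrow> c \<phi>\<close>. Dividing by \<open>t - t\<^sub>0\<close>, the factor \<open>c\<close> cancels in the limit.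
  The crossing form is the same pairing, because the graph map is
  \<open>R\<^sub>t v = (-B\<^sub>t\<^sup>* g, A\<^sub>t\<^sup>* g) - v\<close> with \<open>g = (A\<^sub>0 A\<^sub>t\<^sup>* + B\<^sub>0 B\<^sub>t\<^sup>*)\<inverse> (A\<^sub>0 v\<^sub>2 - B\<^sub>0 v\<^sub>1)\<close>.
\<close>

section \<open>Matrices and the sesquilinear form\<close>

text \<open>The hypotheses supply no branch of eigenfunctions that is continuous in
  \<open>t\<close>, and the eigenvalue curve is only assumed continuous at \<open>t0\<close>;
  differentiability is part of the conclusion. This is why the argument runs along sequences: the
  multiple \<open>c\<close> of \<open>u\<close> may depend on the subsequence, but the limit of the
  quotients does not. Green's identity is exact in \<open>t\<close>, so no derivative of an
  eigenfunction with respect to \<open>t\<close> is ever taken. Two matrices must be kept apart.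
  \<open>A A* + B B*\<close> is invertible by the rank condition and supplies coordinates on the
  planes, also at nearby parameters. \<open>A A* - B B*\<close> arises from inserting
  \<open>Tr u = (-B* phi, A* phi)\<close> into \<open>B gammaD u + A gammaN u\<close>; its inverse
  recovers \<open>phi\<close> from the traces. Because \<open>q\<close> is bounded only almost
  everywhere, the equation is used in integrated form with a pointwise bounded representative
  \<open>Q\<close>. First derivatives of solutions are then merely Lipschitz, so Green's identity
  needs its own integration by parts. The crossing form selects a graph map by \<open>SOME\<close>,
  hence both existence and local uniqueness of such maps must be shown.\<close>

lemma cinner_add_left: "cinner (x + y) z = cinner x z + cinner y z"
  by (simp add: cinner_def algebra_simps sum.distrib)

lemma cinner_add_right: "cinner x (y + z) = cinner x y + cinner x z"
  by (simp add: cinner_def algebra_simps sum.distrib)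

lemma cinner_diff_left: "cinner (x - y) z = cinner x z - cinner y z"
  by (simp add: cinner_def algebra_simps sum_subtractf)

lemma cinner_diff_right: "cinner x (y - z) = cinner x y - cinner x z"
  by (simp add: cinner_def algebra_simps sum_subtractf)

lemma cinner_minus_left [simp]: "cinner (- x) y = - cinner x y"
  by (simp add: cinner_def sum_negf)

lemma cinner_minus_right [simp]: "cinner x (- y) = - cinner x y"
  by (simp add: cinner_def sum_negf)

lemma cinner_zero_left [simp]: "cinner 0 y = 0"
  by (simp add: cinner_def)

lemma cinner_zero_right [simp]: "cinner x 0 = 0"
  by (simp add: cinner_def)

lemma cinner_scale_right: "cinner x (c *s y) = cnj c * cinner x y"
  by (simp add: cinner_def sum_distrib_left algebra_simps)

lemma cinner_self_eq_0_iff: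
  fixes x :: "complex ^ 'n::finite"
  shows "cinner x x = 0 \<longleftrightarrow> x = 0"
proof -
  have "cinner x x = of_real (\<Sum>i\<in>UNIV. (cmod (x $ i))\<^sup>2)"
    by (simp add: cinner_def complex_norm_square del: of_real_power)
  moreover have "(\<Sum>i\<in>UNIV. (cmod (x $ i))\<^sup>2) = 0 \<longleftrightarrow> x = 0"
    by (simp add: sum_nonneg_eq_0_iff vec_eq_iff)
  ultimately show ?thesis
    by (metis of_real_eq_0_iff)
qed

text \<open>Conjugate-linearity is still real-linearity, and the dimension is finite, so the limit
  and product rules for bounded bilinear maps apply. The same holds for \<open>adj\<close>
  below.\<close>

lemma bounded_bilinear_cinner: "bounded_bilinear (cinner :: complex ^ 'n::finite \<Rightarrow> _)"
  unfolding bilinear_conv_bounded_bilinear[symmetric] bilinear_def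
  by (auto intro!: linearI simp: cinner_add_left cinner_add_right)
     (simp_all add: cinner_def scaleR_sum_right)

lemma cinner_matrix_left:
  fixes A :: "complex ^ 'n::finite ^ 'm::finite"
  shows "cinner (A *v x) y = cinner x (adj A *v y)"
proof -
  have "cinner (A *v x) y = (\<Sum>i\<in>UNIV. \<Sum>j\<in>UNIV. A $ i $ j * x $ j * cnj (y $ i))"
    by (simp add: cinner_def matrix_vector_mult_def sum_distrib_right)
  also have "\<dots> = (\<Sum>j\<in>UNIV. \<Sum>i\<in>UNIV. A $ i $ j * x $ j * cnj (y $ i))"
    by (rule sum.swap)
  also have "\<dots> = cinner x (adj A *v y)"
    by (simp add: cinner_def matrix_vector_mult_def adj_def sum_distrib_left algebra_simps)
  finally show ?thesis .
qed

lemma adj_adj [simp]: "adj (adj A) = A"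
  by (simp add: adj_def vec_eq_iff)

lemma cinner_matrix_right:
  fixes A :: "complex ^ 'n::finite ^ 'm::finite"
  shows "cinner y (A *v x) = cinner (adj A *v y) x"
  by (simp add: cinner_matrix_left)

lemma bounded_linear_adj: "bounded_linear (adj :: complex ^ 'n::finite ^ 'm::finite \<Rightarrow> _)"
  unfolding linear_conv_bounded_linear[symmetric]
  by (rule linearI) (simp_all add: adj_def vec_eq_iff)

lemma bounded_bilinear_matrix_vector:
  "bounded_bilinear ((*v) :: complex ^ 'n::finite ^ 'm::finite \<Rightarrow> _)"
  unfolding bilinear_conv_bounded_bilinear[symmetric] bilinear_def
  by (auto intro!: linearI simp: matrix_vector_right_distrib matrix_vector_mult_add_rdistrib)
     (simp_all add: matrix_vector_mult_def vec_eq_iff scaleR_sum_right)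

lemma bounded_bilinear_matrix_matrix:
  "bounded_bilinear ((**) :: complex ^ 'n::finite ^ 'm::finite \<Rightarrow> complex ^ 'k::finite ^ 'n \<Rightarrow> _)"
  unfolding bilinear_conv_bounded_bilinear[symmetric] bilinear_def
  by (auto intro!: linearI simp: matrix_add_ldistrib)
     (simp_all add: matrix_matrix_mult_def vec_eq_iff scaleR_sum_right sum.distrib algebra_simps)

lemmas tendsto_matrix_vector = bounded_bilinear.tendsto[OF bounded_bilinear_matrix_vector]
lemmas tendsto_matrix_matrix = bounded_bilinear.tendsto[OF bounded_bilinear_matrix_matrix]
lemmas tendsto_adj = bounded_linear.tendsto[OF bounded_linear_adj]

lemma
  fixes X :: "complex ^ 'n::finite ^ 'm::finite"
  assumes "invertible X"
  shows matrix_inv_right: "X ** matrix_inv X = mat 1"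
    and matrix_inv_left: "matrix_inv X ** X = mat 1"
  using someI_ex[OF assms[unfolded invertible_def]] by (simp_all add: matrix_inv_def)

lemma matrix_inv_mult_vector:
  fixes X :: "complex ^ 'n::finite ^ 'n"
  assumes "invertible X"
  shows "X *v (matrix_inv X *v x) = x" and "matrix_inv X *v (X *v x) = x"
  using assms by (simp_all add: matrix_vector_mul_assoc matrix_inv_right matrix_inv_left)

lemma invertible_if_kernel_trivial:
  fixes X :: "complex ^ 'n::finite ^ 'n"
  assumes "\<And>x. X *v x = 0 \<Longrightarrow> x = 0"
  shows "invertible X"
  using assms by (metis invertible_left_inverse matrix_left_invertible_ker)

section \<open>Continuity and differentiability of matrix inversion\<close>

lemma tendsto_det:
  fixes X :: "'a \<Rightarrow> complex ^ 'n::finite ^ 'n"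
  assumes "(X \<longlongrightarrow> L) F"
  shows "((\<lambda>s. det (X s)) \<longlongrightarrow> det L) F"
  unfolding det_def by (intro tendsto_intros assms)

lemma eventually_invertible:
  fixes X :: "'a \<Rightarrow> complex ^ 'n::finite ^ 'n"
  assumes "(X \<longlongrightarrow> L) F" and "invertible L"
  shows "\<forall>\<^sub>F s in F. invertible (X s)"
proof -
  have "\<forall>\<^sub>F s in F. det (X s) \<noteq> 0"
    using tendsto_imp_eventually_ne[OF tendsto_det[OF assms(1)]] assms(2) invertible_det_nz by blast
  then show ?thesis
    by (simp add: invertible_det_nz)
qed

text \<open>Column \<open>l\<close> of the inverse solves \<open>X *v x = axis l 1\<close>, so
  Cramer's rule applies to it. Continuity of inversion thereby reduces to continuity of
  \<open>det\<close>.\<close>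

lemma matrix_inv_cramer:
  fixes X :: "complex ^ 'n::finite ^ 'n"
  assumes "invertible X"
  shows "matrix_inv X $ k $ l =
    det (\<chi> i j. if j = k then axis l 1 $ i else X $ i $ j) / det X"
proof -
  have "X *v (matrix_inv X *v axis l 1) = axis l 1"
    using assms by (rule matrix_inv_mult_vector)
  then have "matrix_inv X *v axis l 1 =
      (\<chi> k. det (\<chi> i j. if j = k then axis l 1 $ i else X $ i $ j) / det X)"
    using cramer[of X] assms invertible_det_nz by blast
  moreover have "(matrix_inv X *v axis l 1) $ k = matrix_inv X $ k $ l"
    by (simp add: matrix_vector_mult_def axis_def if_distrib[of "(*) _"] cong: if_cong)
  ultimately show ?thesis
    by simp
qed

lemma tendsto_matrix_inv:
  fixes X :: "'a \<Rightarrow> complex ^ 'n::finite ^ 'n"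
  assumes X: "(X \<longlongrightarrow> L) F" and L: "invertible L"
  shows "((\<lambda>s. matrix_inv (X s)) \<longlongrightarrow> matrix_inv L) F"
proof (intro vec_tendstoI)
  fix k l
  have "((\<lambda>s. det (\<chi> i j. if j = k then axis l 1 $ i else X s $ i $ j) / det (X s))
      \<longlongrightarrow> det (\<chi> i j. if j = k then axis l 1 $ i else L $ i $ j) / det L) F"
  proof (intro tendsto_divide tendsto_det X)
    show "((\<lambda>s. \<chi> i j. if j = k then axis l 1 $ i else X s $ i $ j) \<longlongrightarrow>
        (\<chi> i j. if j = k then axis l 1 $ i else L $ i $ j)) F"
      by (intro tendsto_vec_lambda) (auto intro!: tendsto_intros X)
    show "det L \<noteq> 0"
      using L by (simp add: invertible_det_nz)
  qed
  moreover have "\<forall>\<^sub>F s in F. matrix_inv (X s) $ k $ l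
      = det (\<chi> i j. if j = k then axis l 1 $ i else X s $ i $ j) / det (X s)"
    using eventually_invertible[OF X L] by eventually_elim (rule matrix_inv_cramer)
  ultimately show "((\<lambda>s. matrix_inv (X s) $ k $ l) \<longlongrightarrow> matrix_inv L $ k $ l) F"
    unfolding matrix_inv_cramer[OF L] by (simp add: tendsto_cong)
qed

text \<open>The library definition divides the remainder by \<open>norm (s - t)\<close>, the
  difference quotient by \<open>s - t\<close>; they differ by a sign that the norm does not
  see.\<close>

lemma has_vector_derivative_iff_tendsto:
  fixes f :: "real \<Rightarrow> 'a::real_normed_vector"
  shows "(f has_vector_derivative D) (at t) \<longleftrightarrow> ((\<lambda>s. (f s - f t) /\<^sub>R (s - t)) \<longlongrightarrow> D) (at t)"
proof -
  have "norm ((f s - f t - (s - t) *\<^sub>R D) /\<^sub>R norm (s - t)) = norm ((f s - f t) /\<^sub>R (s - t) - D)"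
    if "s \<noteq> t" for s
  proof -
    have "(f s - f t) /\<^sub>R (s - t) - D = (f s - f t - (s - t) *\<^sub>R D) /\<^sub>R (s - t)"
      using that by (simp add: scaleR_right_diff_distrib)
    then show ?thesis
      by simp
  qed
  then have "((\<lambda>s. norm ((f s - f t - (s - t) *\<^sub>R D) /\<^sub>R norm (s - t))) \<longlongrightarrow> 0) (at t)
      \<longleftrightarrow> ((\<lambda>s. norm ((f s - f t) /\<^sub>R (s - t) - D)) \<longlongrightarrow> 0) (at t)"
    by (intro filterlim_cong) (auto simp: eventually_at_filter)
  then show ?thesis
    unfolding has_vector_derivative_def has_derivative_at_within tendsto_norm_zero_iff
    by (simp add: bounded_linear_scaleR_left LIM_zero_iff)
qed

text \<open>From \<open>X(s)^-1 - X(t)^-1 = - X(s)^-1 (X(s) - X(t)) X(t)^-1\<close>, continuity of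
  inversion and differentiability of \<open>X\<close> suffice.\<close>

lemma has_vector_derivative_matrix_inv:
  fixes X :: "real \<Rightarrow> complex ^ 'n::finite ^ 'n"
  assumes X: "(X has_vector_derivative X') (at t)" and inv: "invertible (X t)"
  shows "((\<lambda>s. matrix_inv (X s)) has_vector_derivative
    - (matrix_inv (X t) ** X' ** matrix_inv (X t))) (at t)"
proof -
  interpret mm: bounded_bilinear "(**) :: complex ^ 'n ^ 'n \<Rightarrow> complex ^ 'n ^ 'n \<Rightarrow> _"
    by (rule bounded_bilinear_matrix_matrix)
  have cX: "X \<midarrow>t\<rightarrow> X t"
    using has_vector_derivative_continuous[OF X] by (simp add: isCont_def)
  have "((\<lambda>s. (X s - X t) /\<^sub>R (s - t)) \<longlongrightarrow> X') (at t)"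
    using X by (simp add: has_vector_derivative_iff_tendsto)
  then have "((\<lambda>s. - (matrix_inv (X s) ** ((X s - X t) /\<^sub>R (s - t)) ** matrix_inv (X t)))
      \<longlongrightarrow> - (matrix_inv (X t) ** X' ** matrix_inv (X t))) (at t)"
    by (intro tendsto_minus tendsto_matrix_matrix tendsto_const tendsto_matrix_inv[OF cX inv])
  moreover have "\<forall>\<^sub>F s in at t.
      - (matrix_inv (X s) ** ((X s - X t) /\<^sub>R (s - t)) ** matrix_inv (X t))
      = (matrix_inv (X s) - matrix_inv (X t)) /\<^sub>R (s - t)"
    using eventually_invertible[OF cX inv]
  proof eventually_elim
    case (elim s)
    have "matrix_inv (X s) ** (X s - X t) ** matrix_inv (X t)
        = (matrix_inv (X s) ** X s) ** matrix_inv (X t) - matrix_inv (X s) ** (X t ** matrix_inv (X t))"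
      by (simp add: mm.diff_right mm.diff_left matrix_mul_assoc)
    also have "\<dots> = matrix_inv (X t) - matrix_inv (X s)"
      using elim inv by (simp add: matrix_inv_right matrix_inv_left)
    finally show ?case
      by (simp add: mm.scaleR_right mm.scaleR_left flip: scaleR_minus_right)
  qed
  ultimately show ?thesis
    unfolding has_vector_derivative_iff_tendsto by (rule Lim_transform_eventually)
qed

section \<open>Lagrangian planes and the crossing form\<close>

text \<open>\<open>rank\<close> is the dimension of the set of rows. Full rank first forces the
  indexed rows to be pairwise distinct; only then does a relation over indices become a relation
  over that set.\<close>

lemma rows_independent_if_full_rank:
  fixes M :: "complex ^ 'n::finite ^ 'm::finite"
  assumes rk: "rank M = CARD('m)" and sum0: "(\<Sum>i\<in>UNIV. c i *s row i M) = 0"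
  shows "c i = 0"
proof -
  have rows: "rows M = range (\<lambda>i. row i M)"
    by (auto simp: rows_def)
  have "vec.dim (rows M) \<le> card (rows M)"
    by (simp add: vec.dim_le_card' rows)
  moreover have "card (rows M) \<le> CARD('m)"
    unfolding rows by (rule card_image_le) simp
  ultimately have card: "card (rows M) = CARD('m)" and dim: "vec.dim (rows M) = card (rows M)"
    using rk by (simp_all add: row_rank_def_gen)
  have inj: "inj (\<lambda>i. row i M)"
    using card unfolding rows by (intro eq_card_imp_inj_on) simp_all
  have indep: "vec.independent (rows M)"
    by (rule vec.card_le_dim_spanning[of _ "rows M"]) (simp_all add: dim[unfolded rows] vec.span_superset rows)
  have "(\<Sum>v\<in>rows M. c (inv (\<lambda>i. row i M) v) *s v) = 0"
    unfolding rows using sum0 by (simp add: sum.reindex[OF inj] inv_f_f[OF inj])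
  then have "c (inv (\<lambda>i. row i M) (row i M)) = 0"
    using vec.independentD[OF indep _ subset_refl, of "\<lambda>v. c (inv (\<lambda>i. row i M) v)" "row i M"]
    by (simp add: rows)
  then show ?thesis
    by (simp add: inv_f_f[OF inj])
qed

section \<open>Frame coordinates on the plane of a boundary condition\<close>

definition frame :: "complex ^ 'p ^ 'p \<Rightarrow> complex ^ 'p ^ 'p \<Rightarrow> complex ^ 'p \<Rightarrow> 'p::finite bpair" where
  "frame A B g = (- (adj B *v g), adj A *v g)"

text \<open>The adjoint of \<open>frame\<close> with respect to \<open>pinner\<close> (see
  \<open>pinner_frame\<close>), so its kernel is the orthogonal complement of the range of
  \<open>frame\<close>.\<close>

definition coframe :: "complex ^ 'p ^ 'p \<Rightarrow> complex ^ 'p ^ 'p \<Rightarrow> 'p::finite bpair \<Rightarrow> complex ^ 'p" where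
  "coframe A B v = A *v snd v - B *v fst v"

lemma matrix_vector_mult_minus: "M *v (- g) = - (M *v g)" for M :: "complex ^ 'n::finite ^ 'm::finite"
  by (rule bounded_bilinear.minus_right[OF bounded_bilinear_matrix_vector])

lemma pinner_frame: "pinner (frame A B g) w = cinner g (coframe A B w)"
  by (simp add: pinner_def frame_def coframe_def cinner_matrix_left cinner_diff_right)

lemma coframe_frame: "coframe A B (frame A' B' g) = (A ** adj A' + B ** adj B') *v g"
  by (simp add: coframe_def frame_def matrix_vector_mult_add_rdistrib
      flip: matrix_vector_mul_assoc)
     (simp add: matrix_vector_mult_minus)

lemma coframe_add: "coframe A B (v + w) = coframe A B v + coframe A B w"
  by (simp add: coframe_def matrix_vector_right_distrib)

lemma coframe_diff: "coframe A B (v - w) = coframe A B v - coframe A B w"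
  by (simp add: coframe_def matrix_vector_mult_diff_distrib)

lemma coframe_pscale: "coframe A B (pscale c v) = c *s coframe A B v"
  by (simp add: coframe_def pscale_def vector_scalar_commute)

lemma frame_add: "frame A B (g + h) = frame A B g + frame A B h"
  by (simp add: frame_def matrix_vector_right_distrib)

lemma frame_scale: "frame A B (c *s g) = pscale c (frame A B g)"
  by (simp add: frame_def pscale_def vector_scalar_commute)

lemma omega_eq_cinner: "omega v w = cinner (snd v) (fst w) - cinner (fst v) (snd w)"
  by (simp add: omega_def cinner_def sum_subtractf)

lemma omega_add_right: "omega v (w + w') = omega v w + omega v w'"
  by (simp add: omega_eq_cinner cinner_add_right)

text \<open>For equal pairs the matrix is zero by the symmetry condition, which is isotropy of the
  plane. For nearby pairs its first-order part produces both the eigenvalue derivative and the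
  crossing form.\<close>

lemma omega_frame:
  "omega (frame A B g) (frame A' B' h) = cinner ((A' ** adj B - B' ** adj A) *v g) h"
  by (simp add: omega_eq_cinner frame_def cinner_matrix_right cinner_diff_left
      matrix_vector_mult_diff_rdistrib matrix_vector_mult_minus flip: matrix_vector_mul_assoc)

text \<open>Pairing with \<open>x\<close> gives the sum of the squared norms of
  \<open>adj A *v x\<close> and \<open>adj B *v x\<close>, so a kernel vector is annihilated by both
  adjoints. That is a linear relation between the rows of \<open>hcat A B\<close>.\<close>

lemma invertible_gram:
  fixes A B :: "complex ^ 'p::finite ^ 'p"
  assumes "rank (hcat A B) = CARD('p)"
  shows "invertible (A ** adj A + B ** adj B)"
proof (rule invertible_if_kernel_trivial)
  fix x
  assume "(A ** adj A + B ** adj B) *v x = 0"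
  then have "cinner (A *v (adj A *v x) + B *v (adj B *v x)) x = 0"
    by (simp add: matrix_vector_mult_add_rdistrib matrix_vector_mul_assoc)
  then have "cinner (adj A *v x) (adj A *v x) + cinner (adj B *v x) (adj B *v x) = 0"
    by (simp add: cinner_matrix_left cinner_add_left)
  then have "of_real ((\<Sum>i\<in>UNIV. (cmod ((adj A *v x) $ i))\<^sup>2) + (\<Sum>i\<in>UNIV. (cmod ((adj B *v x) $ i))\<^sup>2)) = (0 :: complex)"
    by (simp add: cinner_def complex_norm_square del: of_real_power)
  then have "(\<Sum>i\<in>UNIV. (cmod ((adj A *v x) $ i))\<^sup>2) + (\<Sum>i\<in>UNIV. (cmod ((adj B *v x) $ i))\<^sup>2) = 0"
    unfolding of_real_eq_0_iff .
  then have "(\<Sum>i\<in>UNIV. (cmod ((adj A *v x) $ i))\<^sup>2) = 0 \<and> (\<Sum>i\<in>UNIV. (cmod ((adj B *v x) $ i))\<^sup>2) = 0"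
    by (subst (asm) add_nonneg_eq_0_iff) (auto intro: sum_nonneg)
  then have 0: "adj A *v x = 0" "adj B *v x = 0"
    by (auto simp: sum_nonneg_eq_0_iff vec_eq_iff)
  \<comment> \<open>The entries of the adjoints are conjugated, so the coefficients of the row
    relation are the conjugates of those of \<open>x\<close>.\<close>
  have "(\<Sum>i\<in>UNIV. cnj (x $ i) *s row i (hcat A B)) = 0"
    unfolding vec_eq_iff
  proof
    fix j
    have "(\<Sum>i\<in>UNIV. x $ i * cnj (hcat A B $ i $ j)) = 0"
      using 0 by (cases j) (auto simp: vec_eq_iff matrix_vector_mult_def adj_def hcat_def mult.commute)
    then have "cnj (\<Sum>i\<in>UNIV. x $ i * cnj (hcat A B $ i $ j)) = 0"
      by (simp only: complex_cnj_zero)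
    then show "(\<Sum>i\<in>UNIV. cnj (x $ i) *s row i (hcat A B)) $ j = 0 $ j"
      by (simp add: row_def del: complex_cnj_zero_iff)
  qed
  then have "cnj (x $ i) = 0" for i
    by (rule rows_independent_if_full_rank[OF assms])
  then show "x = 0"
    by (simp add: vec_eq_iff)
qed

text \<open>For the nontrivial inclusion, the square system
  \<open>v \<mapsto> (A v\<^sub>1 + B v\<^sub>2, A v\<^sub>2 - B v\<^sub>1)\<close> has an explicit right inverse built from the Gram matrix,
  hence it is injective.\<close>
lemma bc_plane_eq_range_frame:
  fixes A B :: "complex ^ 'p::finite ^ 'p"
  assumes rk: "rank (hcat A B) = CARD('p)" and sym: "A ** adj B = B ** adj A"
  shows "bc_plane A B = range (frame A B)"
proof
  have sym': "A *v (adj B *v g) = B *v (adj A *v g)" for g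
    by (simp add: matrix_vector_mul_assoc sym)
  show "range (frame A B) \<subseteq> bc_plane A B"
    by (auto simp: bc_plane_def frame_def sym' matrix_vector_mult_minus)
  define N where "N = matrix_inv (A ** adj A + B ** adj B)"
  have N: "A *v (adj A *v (N *v g)) + B *v (adj B *v (N *v g)) = g" for g
    using matrix_inv_mult_vector(1)[OF invertible_gram[OF rk], of g]
    by (simp add: N_def matrix_vector_mult_add_rdistrib flip: matrix_vector_mul_assoc)
  define S where "S = (\<lambda>v :: 'p bpair. (A *v fst v + B *v snd v, A *v snd v - B *v fst v))"
  \<comment> \<open>\<open>T\<close> is the adjoint of \<open>S\<close> applied after
    \<open>N\<close> in each slot. In \<open>S\<close> times its adjoint the off-diagonal blocks
    cancel by symmetry and both diagonal blocks are the Gram matrix.\<close>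
  define T where "T = (\<lambda>v :: 'p bpair.
    (adj A *v (N *v fst v) - adj B *v (N *v snd v), adj B *v (N *v fst v) + adj A *v (N *v snd v)))"
  have ST: "S (T v) = v" for v
  proof -
    define x y where "x = N *v fst v" and "y = N *v snd v"
    have "S (T v) = (A *v (adj A *v x) + B *v (adj B *v x), A *v (adj A *v y) + B *v (adj B *v y))"
      unfolding S_def T_def x_def[symmetric] y_def[symmetric]
      by (simp add: matrix_vector_right_distrib matrix_vector_mult_diff_distrib sym')
    then show ?thesis
      by (simp add: N x_def y_def)
  qed
  have "linear S"
    by (rule linearI)
       (auto simp: S_def matrix_vector_right_distrib scaleR_right_distrib scaleR_right_diff_distrib
         bounded_bilinear.scaleR_right[OF bounded_bilinear_matrix_vector])
  moreover have "surj S"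
    using ST by (metis surj_def)
  ultimately have "inj S"
    by (rule linear_surjective_imp_injective) simp
  show "bc_plane A B \<subseteq> range (frame A B)"
  proof
    fix v assume "v \<in> bc_plane A B"
    then have "S v = (0, coframe A B v)"
      by (auto simp: bc_plane_def S_def coframe_def)
    then have "S v = S (T (0, coframe A B v))"
      by (simp add: ST)
    then have "v = T (0, coframe A B v)"
      using \<open>inj S\<close> by (simp add: inj_eq)
    also have "\<dots> = frame A B (N *v coframe A B v)"
      by (simp add: T_def frame_def)
    finally show "v \<in> range (frame A B)"
      by blast
  qed
qed

lemma tendsto_frame:
  assumes "(A \<longlongrightarrow> A0) F" "(B \<longlongrightarrow> B0) F" "(g \<longlongrightarrow> g0) F"
  shows "((\<lambda>s. frame (A s) (B s) (g s)) \<longlongrightarrow> frame A0 B0 g0) F"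
  unfolding frame_def
  by (rule tendsto_Pair[OF tendsto_minus[OF tendsto_matrix_vector[OF tendsto_adj[OF assms(2)] assms(3)]]
      tendsto_matrix_vector[OF tendsto_adj[OF assms(1)] assms(3)]])

lemma has_vector_derivative_frame:
  assumes "(A has_vector_derivative A') (at t)" "(B has_vector_derivative B') (at t)"
    "(g has_vector_derivative g') (at t)"
  shows "((\<lambda>s. frame (A s) (B s) (g s)) has_vector_derivative
    frame (A t) (B t) g' + frame A' B' (g t)) (at t)"
proof -
  note adj = bounded_linear.has_vector_derivative[OF bounded_linear_adj]
  note mv = bounded_bilinear.has_vector_derivative[OF bounded_bilinear_matrix_vector]
  have "((\<lambda>s. frame (A s) (B s) (g s)) has_vector_derivative
    (- (adj (B t) *v g' + adj B' *v g t), adj (A t) *v g' + adj A' *v g t)) (at t)"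
    unfolding frame_def
    by (rule has_vector_derivative_Pair[OF
          has_vector_derivative_minus[OF mv[OF adj[OF assms(2)] assms(3)]] mv[OF adj[OF assms(1)] assms(3)]])
  then show ?thesis
    by (simp add: frame_def)
qed

section \<open>A continuously differentiable path of planes, over an open parameter set so that
  derivatives are two-sided\<close>

locale lagrangian_path =
  fixes A B Ad Bd :: "real \<Rightarrow> complex ^ 'p::finite ^ 'p" and S :: "real set"
  assumes open_S: "open S"
    and A_deriv: "t \<in> S \<Longrightarrow> (A has_vector_derivative Ad t) (at t)"
    and B_deriv: "t \<in> S \<Longrightarrow> (B has_vector_derivative Bd t) (at t)"
    and Ad_cont: "continuous_on S Ad"
    and Bd_cont: "continuous_on S Bd"
    and full_rank: "t \<in> S \<Longrightarrow> rank (hcat (A t) (B t)) = CARD('p)"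
    and symm: "t \<in> S \<Longrightarrow> A t ** adj (B t) = B t ** adj (A t)"
begin

abbreviation plane :: "real \<Rightarrow> 'p bpair set" where
  "plane t \<equiv> bc_plane (A t) (B t)"

text \<open>The composite of \<open>frame\<close> at \<open>t\<close> with \<open>coframe\<close> at
  \<open>s\<close>: in coordinates, it governs the projection of one plane to the other. It is the
  Gram matrix at \<open>t = s\<close>, hence stays invertible nearby, and exactly this makes the
  plane at \<open>t\<close> a graph.\<close>

definition mixed_gram :: "real \<Rightarrow> real \<Rightarrow> complex ^ 'p ^ 'p" where
  "mixed_gram s t = A s ** adj (A t) + B s ** adj (B t)"

text \<open>The point of the plane at \<open>t\<close> whose orthogonal projection to the plane at \<open>s\<close> is \<open>v\<close>.\<close>
definition lift :: "real \<Rightarrow> real \<Rightarrow> 'p bpair \<Rightarrow> 'p bpair" where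
  "lift s t v = frame (A t) (B t) (matrix_inv (mixed_gram s t) *v coframe (A s) (B s) v)"

lemma plane_eq: "t \<in> S \<Longrightarrow> plane t = range (frame (A t) (B t))"
  by (rule bc_plane_eq_range_frame[OF full_rank symm])

lemma A_tendsto: "t \<in> S \<Longrightarrow> (A \<longlongrightarrow> A t) (at t within X)"
  and B_tendsto: "t \<in> S \<Longrightarrow> (B \<longlongrightarrow> B t) (at t within X)"
  using has_vector_derivative_continuous[OF has_vector_derivative_at_within[OF A_deriv]]
    has_vector_derivative_continuous[OF has_vector_derivative_at_within[OF B_deriv]]
  by (simp_all add: continuous_within)

lemma mixed_gram_tendsto: "t \<in> S \<Longrightarrow> (mixed_gram s \<longlongrightarrow> mixed_gram s t) (at t within X)"
  unfolding mixed_gram_def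
  by (intro tendsto_add tendsto_matrix_matrix tendsto_adj tendsto_const A_tendsto B_tendsto)

lemma invertible_mixed_gram_self: "t \<in> S \<Longrightarrow> invertible (mixed_gram t t)"
  unfolding mixed_gram_def by (rule invertible_gram[OF full_rank])

lemma invertible_mixed_gram_near:
  assumes "s \<in> S"
  obtains \<epsilon> where "\<epsilon> > 0" "ball s \<epsilon> \<subseteq> S" "\<And>t. t \<in> ball s \<epsilon> \<Longrightarrow> invertible (mixed_gram s t)"
proof -
  have "\<forall>\<^sub>F t in nhds s. invertible (mixed_gram s t)"
    using eventually_invertible[OF mixed_gram_tendsto[OF assms, of s UNIV] invertible_mixed_gram_self[OF assms]]
    using invertible_mixed_gram_self[OF assms] by (simp add: eventually_nhds_conv_at)
  moreover have "\<forall>\<^sub>F t in nhds s. t \<in> S"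
    using assms open_S by (simp add: eventually_nhds_in_open)
  ultimately have "\<forall>\<^sub>F t in nhds s. invertible (mixed_gram s t) \<and> t \<in> S"
    by (rule eventually_conj)
  then obtain \<epsilon> where "\<epsilon> > 0" and "\<And>t. dist t s < \<epsilon> \<Longrightarrow> invertible (mixed_gram s t) \<and> t \<in> S"
    by (auto simp: eventually_nhds_metric)
  then show ?thesis
    by (intro that[of \<epsilon>]) (auto simp: dist_commute)
qed

text \<open>The first summand comes from the moving coordinates and stays in the plane at
  \<open>t\<close>; the second comes from the moving frame. At \<open>t = s\<close> only the second
  is seen by \<open>omega\<close>. The explicit form is also what shows that the derivative is
  continuous in \<open>t\<close>.\<close>

lemma lift_has_vector_derivative:
  assumes "t \<in> S" "invertible (mixed_gram s t)"
  defines "M \<equiv> matrix_inv (mixed_gram s t)"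
  shows "((\<lambda>t. lift s t v) has_vector_derivative
    frame (A t) (B t) (- (M ** (A s ** adj (Ad t) + B s ** adj (Bd t)) ** M) *v coframe (A s) (B s) v)
    + frame (Ad t) (Bd t) (M *v coframe (A s) (B s) v)) (at t)"
proof -
  note adj = bounded_linear.has_vector_derivative[OF bounded_linear_adj]
  have mm: "((\<lambda>t. X ** adj (Y t)) has_vector_derivative X ** adj Y') (at t)"
    if "(Y has_vector_derivative Y') (at t)" for X and Y :: "real \<Rightarrow> complex ^ 'p ^ 'p" and Y'
    using bounded_linear.has_vector_derivative
      [OF bounded_bilinear.bounded_linear_right[OF bounded_bilinear_matrix_matrix] adj[OF that]] .
  have "(mixed_gram s has_vector_derivative A s ** adj (Ad t) + B s ** adj (Bd t)) (at t)"
    unfolding mixed_gram_def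
    by (intro has_vector_derivative_add mm A_deriv B_deriv assms)
  from has_vector_derivative_matrix_inv[OF this assms(2)]
  have "((\<lambda>t. matrix_inv (mixed_gram s t) *v coframe (A s) (B s) v) has_vector_derivative
    - (M ** (A s ** adj (Ad t) + B s ** adj (Bd t)) ** M) *v coframe (A s) (B s) v) (at t)"
    unfolding M_def
    by (rule bounded_linear.has_vector_derivative
        [OF bounded_bilinear.bounded_linear_left[OF bounded_bilinear_matrix_vector]])
  from has_vector_derivative_frame[OF A_deriv[OF assms(1)] B_deriv[OF assms(1)] this]
  show ?thesis
    unfolding lift_def M_def .
qed

lemma coframe_lift:
  assumes "invertible (mixed_gram s t)"
  shows "coframe (A s) (B s) (lift s t v) = coframe (A s) (B s) v"
  unfolding lift_def coframe_frame mixed_gram_def[symmetric]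
  using assms by (rule matrix_inv_mult_vector)

text \<open>On the plane at \<open>t\<close> the map \<open>coframe\<close> at \<open>s\<close> acts
  on coordinates as the invertible mixed Gram matrix. This identifies arbitrary graph maps and also
  gives coordinates for the traces of nearby eigenfunctions.\<close>

lemma lift_unique:
  assumes "invertible (mixed_gram s t)" and "w \<in> range (frame (A t) (B t))"
    and "coframe (A s) (B s) w = coframe (A s) (B s) v"
  shows "w = lift s t v"
proof -
  obtain g where g: "w = frame (A t) (B t) g"
    using assms(2) by blast
  then have "mixed_gram s t *v g = coframe (A s) (B s) v"
    using assms(3) by (simp add: coframe_frame mixed_gram_def)
  then have "g = matrix_inv (mixed_gram s t) *v coframe (A s) (B s) v"
    using matrix_inv_mult_vector(2)[OF assms(1), of g] by simp
  then show ?thesis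
    by (simp add: g lift_def)
qed

lemma perp_plane_iff:
  assumes "s \<in> S"
  shows "w \<in> perp (plane s) \<longleftrightarrow> coframe (A s) (B s) w = 0"
proof
  assume "w \<in> perp (plane s)"
  then have "cinner (coframe (A s) (B s) w) (coframe (A s) (B s) w) = 0"
    using plane_eq[OF assms] by (auto simp: perp_def pinner_frame)
  then show "coframe (A s) (B s) w = 0"
    by (simp add: cinner_self_eq_0_iff)
next
  assume "coframe (A s) (B s) w = 0"
  then show "w \<in> perp (plane s)"
    using plane_eq[OF assms] by (auto simp: perp_def pinner_frame)
qed

text \<open>The \<open>SOME\<close> inside \<open>crossing_form\<close> carries information only
  once some graph map exists; orthogonality to the base plane holds because \<open>lift\<close>
  preserves \<open>coframe\<close>.\<close>

lemma graph_rep_lift: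
  assumes s: "s \<in> S"
  shows "graph_rep plane s (\<lambda>t v. lift s t v - v)"
proof -
  obtain \<epsilon> where \<epsilon>: "\<epsilon> > 0" "ball s \<epsilon> \<subseteq> S"
      and inv: "\<And>t. t \<in> ball s \<epsilon> \<Longrightarrow> invertible (mixed_gram s t)"
    using invertible_mixed_gram_near[OF s] by blast
  define D where "D = (\<lambda>v t. frame (A t) (B t) (- (matrix_inv (mixed_gram s t) **
      (A s ** adj (Ad t) + B s ** adj (Bd t)) ** matrix_inv (mixed_gram s t)) *v coframe (A s) (B s) v)
    + frame (Ad t) (Bd t) (matrix_inv (mixed_gram s t) *v coframe (A s) (B s) v))"
  have deriv: "((\<lambda>t. lift s t v - v) has_vector_derivative D v t) (at t)" if "t \<in> ball s \<epsilon>" for t v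
    using has_vector_derivative_diff[OF lift_has_vector_derivative has_vector_derivative_const, of t s v v]
      that inv[OF that] \<epsilon>(2) by (auto simp: D_def)
  have lift_self: "lift s s v - v = 0" if "v \<in> plane s" for v
    using lift_unique[of s s v v] invertible_mixed_gram_self[OF s] that plane_eq[OF s] by auto
  have graph: "plane t = {v + (lift s t v - v) | v. v \<in> plane s}" if t: "t \<in> ball s \<epsilon>" for t
  proof
    have "v + (lift s t v - v) \<in> plane t" for v
      using t \<epsilon>(2) by (subst plane_eq) (auto simp: lift_def)
    then show "{v + (lift s t v - v) | v. v \<in> plane s} \<subseteq> plane t"
      by blast
    show "plane t \<subseteq> {v + (lift s t v - v) | v. v \<in> plane s}"
    proof
      fix w assume "w \<in> plane t"
      then have w: "w \<in> range (frame (A t) (B t))"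
        using plane_eq[of t] t \<epsilon>(2) by auto
      \<comment> \<open>\<open>lift s s\<close> is the orthogonal projection onto the plane at
        \<open>s\<close>, so the base point over which \<open>w\<close> lies is the projection of
        \<open>w\<close>.\<close>
      have "lift s t (lift s s w) = w"
        by (rule lift_unique[OF inv[OF t] w, symmetric])
           (simp add: coframe_lift invertible_mixed_gram_self[OF s])
      moreover have "lift s s w \<in> plane s"
        using plane_eq[OF s] by (simp add: lift_def)
      ultimately show "w \<in> {v + (lift s t v - v) | v. v \<in> plane s}"
        unfolding mem_Collect_eq by (intro exI[of _ "lift s s w"]) simp
    qed
  qed
  have add: "lift s t (v + w) = lift s t v + lift s t w" for t v w
    by (simp add: lift_def coframe_add matrix_vector_right_distrib frame_add)
  have scale: "lift s t (pscale c v) - pscale c v = pscale c (lift s t v - v)" for t c v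
    by (simp add: lift_def coframe_pscale vector_scalar_commute frame_scale)
       (simp add: pscale_def vector_ssub_ldistrib prod_eq_iff)
  have perp: "lift s t v - v \<in> perp (plane s)" if "t \<in> ball s \<epsilon>" for t v
    using perp_plane_iff[OF s] inv[OF that] by (simp add: coframe_diff coframe_lift)
  have Ad_tendsto: "(Ad \<longlongrightarrow> Ad t) (at t within ball s \<epsilon>)"
      and Bd_tendsto: "(Bd \<longlongrightarrow> Bd t) (at t within ball s \<epsilon>)" if "t \<in> ball s \<epsilon>" for t
    using continuous_on_subset[OF Ad_cont \<epsilon>(2)] continuous_on_subset[OF Bd_cont \<epsilon>(2)] that
    by (simp_all add: continuous_on_def)
  have D_cont: "continuous_on (ball s \<epsilon>) (D v)" for v
    unfolding continuous_on_def
  proof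
    fix t assume t: "t \<in> ball s \<epsilon>"
    then have tS: "t \<in> S"
      using \<epsilon>(2) by blast
    show "(D v \<longlongrightarrow> D v t) (at t within ball s \<epsilon>)"
      unfolding D_def
      by (intro tendsto_add tendsto_frame tendsto_minus tendsto_matrix_vector tendsto_matrix_matrix
          tendsto_adj tendsto_const tendsto_matrix_inv inv t A_tendsto B_tendsto tS mixed_gram_tendsto
          Ad_tendsto Bd_tendsto)
  qed
  have "continuous_on (ball s \<epsilon>) (\<lambda>t. vector_derivative (\<lambda>t. lift s t v - v) (at t))" for v
    by (rule continuous_on_eq[OF D_cont]) (rule vector_derivative_at[OF deriv, symmetric])
  moreover have "(\<lambda>t. lift s t v - v) differentiable_on ball s \<epsilon>" for v
    using differentiableI_vector[OF deriv] by (rule differentiable_at_imp_differentiable_on)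
  ultimately show ?thesis
    unfolding graph_rep_def
    by (intro conjI exI[of _ \<epsilon>] ballI allI \<epsilon>(1) lift_self graph perp scale) (simp_all add: add)
qed

text \<open>Orthogonality of \<open>R t v\<close> gives \<open>v + R t v\<close> the same
  \<open>coframe\<close> as \<open>v\<close>, and it lies in the plane at \<open>t\<close>, so it
  must be the lift. A graph map is constrained only on the base plane and near \<open>s\<close>,
  which is why the equality is local and restricted to such \<open>v\<close>.\<close>

lemma graph_rep_eq_lift:
  assumes s: "s \<in> S" and R: "graph_rep plane s R" and v: "v \<in> plane s"
  shows "\<forall>\<^sub>F t in nhds s. R t v = lift s t v - v"
proof -
  obtain \<delta> where \<delta>: "\<delta> > 0" and perp: "\<And>t. t \<in> ball s \<delta> \<Longrightarrow> R t v \<in> perp (plane s)"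
      and graph: "\<And>t. t \<in> ball s \<delta> \<Longrightarrow> plane t = {v + R t v | v. v \<in> plane s}"
    using R v unfolding graph_rep_def by blast
  obtain \<epsilon> where \<epsilon>: "\<epsilon> > 0" "ball s \<epsilon> \<subseteq> S"
      and inv: "\<And>t. t \<in> ball s \<epsilon> \<Longrightarrow> invertible (mixed_gram s t)"
    using invertible_mixed_gram_near[OF s] by blast
  have "R t v = lift s t v - v" if t: "t \<in> ball s \<delta> \<inter> ball s \<epsilon>" for t
  proof -
    have "v + R t v = lift s t v"
    proof (rule lift_unique)
      show "invertible (mixed_gram s t)"
        using t inv by blast
      show "v + R t v \<in> range (frame (A t) (B t))"
        using plane_eq[of t] t \<epsilon>(2) graph[of t] v by blast
      show "coframe (A s) (B s) (v + R t v) = coframe (A s) (B s) v"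
        using perp[of t] t by (simp add: perp_plane_iff[OF s] coframe_add)
    qed
    then show ?thesis
      by (simp add: algebra_simps)
  qed
  moreover have "\<forall>\<^sub>F t in nhds s. t \<in> ball s \<delta> \<inter> ball s \<epsilon>"
    using \<delta> \<epsilon> by (intro eventually_nhds_in_open) auto
  ultimately show ?thesis
    by (auto elim: eventually_mono)
qed

text \<open>The derivative of the symmetry condition. Rearranged, it says
  \<open>Bd A* - Ad B* = A Bd* - B Ad*\<close>, which converts both limits computed later into the
  matrix of the theorem.\<close>

lemma deriv_symm:
  assumes "t \<in> S"
  shows "Ad t ** adj (B t) + A t ** adj (Bd t) = Bd t ** adj (A t) + B t ** adj (Ad t)"
proof -
  note adj = bounded_linear.has_vector_derivative[OF bounded_linear_adj]
  note mm = bounded_bilinear.has_vector_derivative[OF bounded_bilinear_matrix_matrix]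
  have "((\<lambda>t. A t ** adj (B t)) has_vector_derivative A t ** adj (Bd t) + Ad t ** adj (B t)) (at t)"
    by (intro mm adj A_deriv B_deriv assms)
  moreover have "((\<lambda>t. B t ** adj (A t)) has_vector_derivative B t ** adj (Ad t) + Bd t ** adj (A t)) (at t)"
    by (intro mm adj A_deriv B_deriv assms)
  then have "((\<lambda>t. A t ** adj (B t)) has_vector_derivative B t ** adj (Ad t) + Bd t ** adj (A t)) (at t)"
    by (rule has_vector_derivative_transform_within_open[OF _ open_S assms]) (simp add: symm)
  ultimately show ?thesis
    by (subst (1 2) add.commute) (rule vector_derivative_unique_at)
qed

lemma crossing_form_frame:
  assumes s: "s \<in> S" and K: "frame (A s) (B s) g \<in> K"
  shows "crossing_form K plane s (frame (A s) (B s) g)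
    = cinner ((A s ** adj (Bd s) - B s ** adj (Ad s)) *v g) g"
proof -
  define R where "R = (SOME R. graph_rep plane s R)"
  have R: "graph_rep plane s R"
    unfolding R_def by (rule someI[of "graph_rep plane s"]) (rule graph_rep_lift[OF s])
  let ?v = "frame (A s) (B s) g"
  have v: "?v \<in> plane s"
    using plane_eq[OF s] by blast
  note inv = invertible_mixed_gram_self[OF s]
  have coeff: "matrix_inv (mixed_gram s s) *v coframe (A s) (B s) ?v = g"
    unfolding coframe_frame mixed_gram_def[symmetric] using inv by (rule matrix_inv_mult_vector)
  \<comment> \<open>The coordinate velocity \<open>h\<close> can stay unspecified: its frame vector
    lies in the plane itself, where \<open>omega\<close> vanishes.\<close>
  obtain h where "((\<lambda>t. lift s t ?v) has_vector_derivative
      frame (A s) (B s) h + frame (Ad s) (Bd s) g) (at s)"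
    using lift_has_vector_derivative[OF s inv, of ?v] unfolding coeff by blast
  then have "((\<lambda>t. lift s t ?v - ?v) has_vector_derivative
      frame (A s) (B s) h + frame (Ad s) (Bd s) g) (at s)"
    by (simp add: has_vector_derivative_diff_const)
  then have "((\<lambda>t. R t ?v) has_vector_derivative
      frame (A s) (B s) h + frame (Ad s) (Bd s) g) (at s)"
    using graph_rep_eq_lift[OF s R v]
    by (subst has_vector_derivative_cong_ev) (auto dest: eventually_nhds_x_imp_x)
  then have "vector_derivative (\<lambda>t. R t ?v) (at s) = frame (A s) (B s) h + frame (Ad s) (Bd s) g"
    by (rule vector_derivative_at)
  then have "crossing_form K plane s ?v
      = - omega ?v (frame (A s) (B s) h + frame (Ad s) (Bd s) g)"
    using K v by (simp add: crossing_form_def R_def)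
  also have "\<dots> = cinner ((Bd s ** adj (A s) - Ad s ** adj (B s)) *v g) g"
  proof -
    have "omega ?v (frame (A s) (B s) h) = 0"
      by (simp add: omega_frame symm[OF s])
    then show ?thesis
      by (simp add: omega_add_right omega_frame matrix_vector_mult_diff_rdistrib cinner_diff_left)
  qed
  also have "Bd s ** adj (A s) - Ad s ** adj (B s) = A s ** adj (Bd s) - B s ** adj (Ad s)"
    using deriv_symm[OF s] by (simp add: algebra_simps)
  finally show ?thesis .
qed

end

section \<open>Sturm--Liouville equations with bounded potential\<close>

lemma has_integral_uniform_limit:
  fixes g :: "nat \<Rightarrow> real \<Rightarrow> 'a::banach"
  assumes ab: "a \<le> b" and g: "\<And>n. (g n has_integral I n) {a..b}"
    and lim: "uniform_limit {a..b} g h sequentially" and I: "I \<longlonglongrightarrow> J"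
  shows "(h has_integral J) {a..b}"
proof -
  have ev: "\<forall>\<^sub>F n in sequentially. \<forall>x\<in>{a..b}. norm (g n x - h x) < e" if "e > 0" for e
    using lim that by (auto simp: uniform_limit_iff dist_norm)
  have h: "h integrable_on {a..b}"
    unfolding cbox_interval[symmetric]
  proof (rule integrable_uniform_limit)
    fix e :: real assume "e > 0"
    then obtain n where n: "\<forall>x\<in>{a..b}. norm (g n x - h x) < e"
      using ev eventually_happens'[OF sequentially_bot] by blast
    show "\<exists>k. (\<forall>x\<in>cbox a b. norm (h x - k x) \<le> e) \<and> k integrable_on cbox a b"
      using n g[of n] by (intro exI[of _ "g n"]) (auto simp: norm_minus_commute less_imp_le)
  qed
  have "I \<longlonglongrightarrow> integral {a..b} h"
  proof (rule tendstoI)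
    fix e :: real assume e: "e > 0"
    \<comment> \<open>The \<open>+ 1\<close> keeps the denominator positive when
      \<open>a = b\<close>; the half makes the final inequality strict.\<close>
    define d where "d = e / 2 / (b - a + 1)"
    have d: "d > 0"
      using e ab by (simp add: d_def)
    have "d * (b - a) \<le> d * (b - a + 1)"
      using d by (intro mult_left_mono) auto
    also have "\<dots> = e / 2"
      using ab nonzero_eq_divide_eq[of "b - a + 1" d "e / 2"] by (simp add: d_def)
    finally have dab: "d * (b - a) < e"
      using e by simp
    show "\<forall>\<^sub>F n in sequentially. dist (I n) (integral {a..b} h) < e"
      using ev[OF d]
    proof eventually_elim
      case (elim n)
      have "((\<lambda>x. g n x - h x) has_integral I n - integral {a..b} h) {a..b}"
        by (intro has_integral_diff g integrable_integral h)
      then have "norm (I n - integral {a..b} h) \<le> d * measure lborel {a..b}"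
        using elim d by (intro has_integral_bound_real[where f = "\<lambda>x. g n x - h x" and B = d]) (auto simp: less_imp_le)
      then show ?case
        using dab ab by (simp add: dist_norm)
    qed
  qed
  then have "integral {a..b} h = J"
    using I LIMSEQ_unique by blast
  with h show ?thesis
    by (simp add: has_integral_iff)
qed

text \<open>Maximise \<open>y\<close> divided by the weight \<open>exp (2 * K * (x - a))\<close>.
  The rate \<open>2 * K\<close>, twice the natural one, makes \<open>K\<close> times the integral up
  to the maximiser at most half of \<open>y\<close> there, so it is absorbed on the left; this also
  costs the factor 2 in front of \<open>c\<close>.\<close>

lemma gronwall_bound:
  fixes y :: "real \<Rightarrow> real"
  assumes cont: "continuous_on {a..b} y" and K: "K > 0" and c: "c \<ge> 0"
    and nonneg: "\<And>x. x \<in> {a..b} \<Longrightarrow> y x \<ge> 0"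
    and le: "\<And>x. x \<in> {a..b} \<Longrightarrow> y x \<le> c + K * integral {a..x} y"
    and x: "x \<in> {a..b}"
  shows "y x \<le> 2 * c * exp (2 * K * (x - a))"
proof -
  let ?E = "\<lambda>x. exp (2 * K * (x - a))"
  have "\<exists>p\<in>{a..b}. \<forall>x\<in>{a..b}. y x / ?E x \<le> y p / ?E p"
    using x by (intro continuous_attains_sup continuous_intros cont) auto
  then obtain p where p: "p \<in> {a..b}" and max: "\<And>x. x \<in> {a..b} \<Longrightarrow> y x / ?E x \<le> y p / ?E p"
    by blast
  define Y where "Y = y p / ?E p"
  have Y: "Y \<ge> 0"
    using nonneg[OF p] by (simp add: Y_def)
  have yle: "y s \<le> Y * ?E s" if "s \<in> {a..b}" for s
    using max[OF that] by (simp add: Y_def[symmetric] pos_divide_le_eq)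
  have int_E: "((\<lambda>s. Y * ?E s) has_integral Y / (2 * K) * ?E p - Y / (2 * K) * ?E a) {a..p}"
  proof (rule fundamental_theorem_of_calculus)
    fix s
    have "((\<lambda>s. Y / (2 * K) * ?E s) has_real_derivative Y / (2 * K) * (?E s * (2 * K))) (at s within {a..p})"
      by (auto intro!: derivative_eq_intros)
    then show "((\<lambda>s. Y / (2 * K) * ?E s) has_vector_derivative Y * ?E s) (at s within {a..p})"
      using K by (simp add: has_real_derivative_iff_has_vector_derivative)
  qed (use p in auto)
  have int_y: "(y has_integral integral {a..p} y) {a..p}"
    using p by (intro integrable_integral integrable_continuous_real continuous_on_subset[OF cont]) auto
  have "integral {a..p} y \<le> Y / (2 * K) * ?E p - Y / (2 * K) * ?E a"
    by (rule has_integral_le[OF int_y int_E yle]) (use p in auto)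
  then have "K * integral {a..p} y \<le> K * (Y / (2 * K) * ?E p - Y / (2 * K))"
    using K by (intro mult_left_mono) auto
  also have "\<dots> = (Y * ?E p - Y) / 2"
    using K by (simp add: right_diff_distrib)
  finally have "y p \<le> c + (Y * ?E p - Y) / 2"
    using le[OF p] by linarith
  moreover have y_p: "Y * ?E p = y p"
    by (simp add: Y_def)
  ultimately have "y p \<le> c + (y p - Y) / 2"
    by simp
  then have "Y * ?E p \<le> 2 * c - Y"
    unfolding y_p by (simp add: field_simps)
  also have "\<dots> \<le> 2 * c"
    using Y by simp
  also have "\<dots> \<le> 2 * c * ?E p"
    using c p K mult_left_mono[of 1 "?E p" "2 * c"] by simp
  finally have "Y \<le> 2 * c"
    by (rule mult_right_le_imp_le) simp
  then show ?thesis
    by (intro order_trans[OF yle[OF x] mult_right_mono]) simp_all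
qed

text \<open>The equation \<open>f'' = V f\<close> in integrated form, with \<open>f1\<close> as the
  derivative; \<open>V\<close> will be \<open>Q - mu\<close>. Nothing is required of a second
  derivative pointwise, and the first-order pair \<open>(f, f1)\<close> is what Gronwall
  controls.\<close>

definition sl_sol :: "real \<Rightarrow> real \<Rightarrow> (real \<Rightarrow> real) \<Rightarrow> (real \<Rightarrow> complex) \<Rightarrow> (real \<Rightarrow> complex) \<Rightarrow> bool" where
  "sl_sol a b V f f1 \<longleftrightarrow>
    (\<forall>x\<in>{a..b}. (f has_vector_derivative f1 x) (at x within {a..b})) \<and>
    (\<forall>x\<in>{a..b}. ((\<lambda>s. of_real (V s) * f s) has_integral f1 x - f1 a) {a..x})"

lemma sl_sol_deriv:
  "sl_sol a b V f f1 \<Longrightarrow> x \<in> {a..b} \<Longrightarrow> (f has_vector_derivative f1 x) (at x within {a..b})"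
  by (simp add: sl_sol_def)

lemma sl_sol_continuous: "sl_sol a b V f f1 \<Longrightarrow> continuous_on {a..b} f"
  by (auto simp: continuous_on_eq_continuous_within intro: has_vector_derivative_continuous sl_sol_deriv)

lemma sl_sol_has_integral:
  assumes "sl_sol a b V f f1" "a \<le> x" "x \<le> y" "y \<le> b"
  shows "((\<lambda>s. of_real (V s) * f s) has_integral f1 y - f1 x) {x..y}"
proof -
  let ?g = "\<lambda>s. of_real (V s) * f s"
  have x: "(?g has_integral f1 x - f1 a) {a..x}" and y: "(?g has_integral f1 y - f1 a) {a..y}"
    using assms by (auto simp: sl_sol_def)
  have int: "?g integrable_on {x..y}"
    using y assms by (intro integrable_on_subinterval[of ?g "{a..y}" x y]) auto
  have "integral {a..x} ?g + integral {x..y} ?g = integral {a..y} ?g"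
    using y assms by (intro Henstock_Kurzweil_Integration.integral_combine) auto
  then have "integral {x..y} ?g = f1 y - f1 x"
    unfolding integral_unique[OF x] integral_unique[OF y] by (simp add: algebra_simps)
  with int show ?thesis
    by (simp add: has_integral_iff)
qed

lemma sl_sol_continuous_deriv:
  assumes "sl_sol a b V f f1"
  shows "continuous_on {a..b} f1"
proof (cases "a \<le> b")
  case True
  have "continuous_on {a..b} (\<lambda>x. f1 a + integral {a..x} (\<lambda>s. of_real (V s) * f s))"
    using sl_sol_has_integral[OF assms, of a b] True
    by (intro continuous_intros indefinite_integral_continuous_1) auto
  then show ?thesis
  proof (rule continuous_on_eq)
    fix x assume "x \<in> {a..b}"
    then have "integral {a..x} (\<lambda>s. of_real (V s) * f s) = f1 x - f1 a"
      using assms by (intro integral_unique) (simp add: sl_sol_def)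
    then show "f1 a + integral {a..x} (\<lambda>s. of_real (V s) * f s) = f1 x"
      by simp
  qed
qed simp

lemma sl_sol_deriv_has_integral:
  assumes "sl_sol a b V f f1" "a \<le> x" "x \<le> y" "y \<le> b"
  shows "(f1 has_integral f y - f x) {x..y}"
  using assms
  by (intro fundamental_theorem_of_calculus)
     (auto intro: has_vector_derivative_within_subset[OF sl_sol_deriv[OF assms(1)]])

text \<open>Splitting \<open>V f - W h\<close> into \<open>V (f - h)\<close> and
  \<open>(V - W) h\<close> turns the difference of potentials into an inhomogeneity of size
  \<open>\<delta> * M\<close>. Two potentials are allowed because the eigenfunctions of a sequence
  belong to different eigenvalues; \<open>h = 0\<close> gives an a priori bound.\<close>

lemma sl_sol_diff_bound:
  assumes f: "sl_sol a b V f f1" and h: "sl_sol a b W h h1"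
    and V: "\<And>x. x \<in> {a..b} \<Longrightarrow> \<bar>V x\<bar> \<le> K"
    and VW: "\<And>x. x \<in> {a..b} \<Longrightarrow> \<bar>V x - W x\<bar> \<le> \<delta>"
    and M: "\<And>x. x \<in> {a..b} \<Longrightarrow> cmod (h x) \<le> M"
    and x: "x \<in> {a..b}"
  shows "cmod (f x - h x) + cmod (f1 x - h1 x)
    \<le> 2 * (cmod (f a - h a) + cmod (f1 a - h1 a) + \<delta> * M * (b - a)) * exp (2 * (K + 1) * (b - a))"
proof -
  define d d1 where "d = (\<lambda>x. f x - h x)" and "d1 = (\<lambda>x. f1 x - h1 x)"
  define c where "c = cmod (d a) + cmod (d1 a) + \<delta> * M * (b - a)"
  have ab: "a \<le> b" "a \<in> {a..b}"
    using x by auto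
  have K0: "K \<ge> 0" and \<delta>0: "\<delta> \<ge> 0" and M0: "M \<ge> 0"
    using V[OF ab(2)] VW[OF ab(2)] M[OF ab(2)] by (force intro: order_trans[OF abs_ge_zero] order_trans[OF norm_ge_zero])+
  have c0: "c \<ge> 0"
    using \<delta>0 M0 ab by (simp add: c_def)
  have cd: "continuous_on {a..b} d" and cd1: "continuous_on {a..b} d1"
    unfolding d_def d1_def
    using sl_sol_continuous[OF f] sl_sol_continuous[OF h] sl_sol_continuous_deriv[OF f] sl_sol_continuous_deriv[OF h]
    by (auto intro: continuous_on_diff)
  let ?y = "\<lambda>x. cmod (d x) + cmod (d1 x)"
  have "?y x \<le> 2 * c * exp (2 * (K + 1) * (x - a))"
  proof (rule gronwall_bound[where b = b])
    show "continuous_on {a..b} ?y"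
      by (intro continuous_intros cd cd1)
    fix z assume z: "z \<in> {a..b}"
    then have sub: "{a..z} \<subseteq> {a..b}"
      by auto
    have int_d: "(\<lambda>s. cmod (d s)) integrable_on {a..z}" and int_d1: "(\<lambda>s. cmod (d1 s)) integrable_on {a..z}"
      by (intro integrable_continuous_real continuous_on_norm continuous_on_subset[OF cd sub]
          continuous_on_subset[OF cd1 sub])+
    have "(d1 has_integral d z - d a) {a..z}"
      using z has_integral_diff[OF sl_sol_deriv_has_integral[OF f, of a z] sl_sol_deriv_has_integral[OF h, of a z]]
      by (simp add: d_def d1_def algebra_simps)
    then have "cmod (d z - d a) \<le> integral {a..z} (\<lambda>s. cmod (d1 s))"
      using integral_norm_bound_integral[OF _ int_d1, of d1] by (auto simp: has_integral_iff)
    moreover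
    have "((\<lambda>s. of_real (V s) * f s - of_real (W s) * h s) has_integral d1 z - d1 a) {a..z}"
      using z has_integral_diff[OF sl_sol_has_integral[OF f, of a z] sl_sol_has_integral[OF h, of a z]]
      by (simp add: d1_def algebra_simps)
    moreover have "cmod (of_real (V s) * f s - of_real (W s) * h s) \<le> K * cmod (d s) + \<delta> * M"
      if "s \<in> {a..z}" for s
    proof -
      have s: "s \<in> {a..b}"
        using that sub by blast
      have "cmod (of_real (V s) * f s - of_real (W s) * h s)
          = cmod (of_real (V s) * d s + of_real (V s - W s) * h s)"
        by (simp add: d_def algebra_simps)
      also have "\<dots> \<le> \<bar>V s\<bar> * cmod (d s) + \<bar>V s - W s\<bar> * cmod (h s)"
        by (rule norm_triangle_le) (simp add: norm_mult flip: of_real_diff)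
      also have "\<dots> \<le> K * cmod (d s) + \<delta> * M"
        using V[OF s] VW[OF s] M[OF s] \<delta>0 by (intro add_mono mult_mono) auto
      finally show ?thesis .
    qed
    moreover have "(\<lambda>s. K * cmod (d s) + \<delta> * M) integrable_on {a..z}"
      using int_d by (intro integrable_add integrable_on_mult_right) auto
    ultimately have dz: "cmod (d z - d a) \<le> integral {a..z} (\<lambda>s. cmod (d1 s))"
      and "cmod (d1 z - d1 a) \<le> integral {a..z} (\<lambda>s. K * cmod (d s) + \<delta> * M)"
      using integral_norm_bound_integral[of "\<lambda>s. of_real (V s) * f s - of_real (W s) * h s" "{a..z}"
          "\<lambda>s. K * cmod (d s) + \<delta> * M"]
      by (auto simp: has_integral_iff)
    then have d1z: "cmod (d1 z - d1 a) \<le> K * integral {a..z} (\<lambda>s. cmod (d s)) + \<delta> * M * (z - a)"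
    proof -
      have "((\<lambda>s. K * cmod (d s) + \<delta> * M) has_integral
          K * integral {a..z} (\<lambda>s. cmod (d s)) + (z - a) *\<^sub>R (\<delta> * M)) {a..z}"
        using z by (intro has_integral_add has_integral_mult_right integrable_integral int_d)
          (use has_integral_const_real[of "\<delta> * M" a z] in auto)
      with \<open>cmod (d1 z - d1 a) \<le> _\<close> show ?thesis
        by (simp add: has_integral_iff mult.commute)
    qed
    have "?y z \<le> ?y a + cmod (d z - d a) + cmod (d1 z - d1 a)"
      using norm_triangle_sub[of "d z" "d a"] norm_triangle_sub[of "d1 z" "d1 a"] by linarith
    also have "\<dots> \<le> ?y a + \<delta> * M * (z - a)
        + (K * integral {a..z} (\<lambda>s. cmod (d s)) + integral {a..z} (\<lambda>s. cmod (d1 s)))"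
      using dz d1z by linarith
    also have "\<delta> * M * (z - a) \<le> \<delta> * M * (b - a)"
      using z \<delta>0 M0 by (intro mult_left_mono) auto
    \<comment> \<open>\<open>K + 1\<close> dominates both coefficients \<open>K\<close> and
      \<open>1\<close>, and is positive, as the Gronwall bound demands, even when
      \<open>K = 0\<close>.\<close>
    also have "K * integral {a..z} (\<lambda>s. cmod (d s)) + integral {a..z} (\<lambda>s. cmod (d1 s))
        \<le> (K + 1) * integral {a..z} (\<lambda>s. cmod (d s)) + (K + 1) * integral {a..z} (\<lambda>s. cmod (d1 s))"
      using K0 integral_nonneg[OF int_d] integral_nonneg[OF int_d1] by (simp add: algebra_simps)
    also have "\<dots> = (K + 1) * integral {a..z} ?y"
      using integral_add[OF int_d int_d1] by (simp add: algebra_simps)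
    finally show "?y z \<le> c + (K + 1) * integral {a..z} ?y"
      by (simp add: c_def)
  qed (use K0 c0 x in auto)
  also have "\<dots> \<le> 2 * c * exp (2 * (K + 1) * (b - a))"
    using x K0 c0 by (intro mult_left_mono) (auto intro: mult_left_mono)
  finally show ?thesis
    by (simp add: d_def d1_def c_def)
qed

lemma sl_sol_zero: "sl_sol a b V (\<lambda>_. 0) (\<lambda>_. 0)"
  by (simp add: sl_sol_def)

lemma sl_sol_bound:
  assumes "sl_sol a b V f f1" and "\<And>x. x \<in> {a..b} \<Longrightarrow> \<bar>V x\<bar> \<le> K" and "x \<in> {a..b}"
  shows "cmod (f x) + cmod (f1 x) \<le> 2 * (cmod (f a) + cmod (f1 a)) * exp (2 * (K + 1) * (b - a))"
  using sl_sol_diff_bound[OF assms(1) sl_sol_zero assms(2), of V 0 0 x] assms(3) by simp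

lemma sl_sol_scale:
  assumes "sl_sol a b V f f1"
  shows "sl_sol a b V (\<lambda>x. c * f x) (\<lambda>x. c * f1 x)"
  unfolding sl_sol_def
proof (intro conjI ballI)
  fix x assume x: "x \<in> {a..b}"
  show "((\<lambda>x. c * f x) has_vector_derivative c * f1 x) (at x within {a..b})"
    using sl_sol_deriv[OF assms x] by (rule has_vector_derivative_mult_right)
  have "((\<lambda>s. c * (of_real (V s) * f s)) has_integral c * (f1 x - f1 a)) {a..x}"
    using sl_sol_has_integral[OF assms, of a x] x by (intro has_integral_mult_right) auto
  then show "((\<lambda>s. of_real (V s) * (c * f s)) has_integral c * f1 x - c * f1 a) {a..x}"
    by (simp add: algebra_simps)
qed

lemma sl_sol_cnj:
  assumes "sl_sol a b V f f1"
  shows "sl_sol a b V (\<lambda>x. cnj (f x)) (\<lambda>x. cnj (f1 x))"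
  unfolding sl_sol_def
proof (intro conjI ballI)
  fix x assume x: "x \<in> {a..b}"
  show "((\<lambda>x. cnj (f x)) has_vector_derivative cnj (f1 x)) (at x within {a..b})"
    using bounded_linear.has_vector_derivative[OF bounded_linear_cnj sl_sol_deriv[OF assms x]] .
  show "((\<lambda>s. of_real (V s) * cnj (f s)) has_integral cnj (f1 x) - cnj (f1 a)) {a..x}"
    using has_integral_linear[OF sl_sol_has_integral[OF assms, of a x] bounded_linear_cnj] x
    by (simp add: o_def)
qed

text \<open>Continuous dependence makes the solutions and their derivatives uniformly Cauchy once
  initial data and potentials converge, so equicontinuity is not invoked. The integrated equation
  then passes to the limit.\<close>

lemma sl_sol_limit:
  assumes ab: "a < b" and sol: "\<And>n. sl_sol a b (V n) (f n) (f1 n)"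
    and K: "\<And>n x. x \<in> {a..b} \<Longrightarrow> \<bar>V n x\<bar> \<le> K"
    and \<delta>: "\<And>n x. x \<in> {a..b} \<Longrightarrow> \<bar>V n x - V' x\<bar> \<le> \<delta> n" and \<delta>0: "\<delta> \<longlonglongrightarrow> 0"
    and p: "(\<lambda>n. f n a) \<longlonglongrightarrow> p" and p1: "(\<lambda>n. f1 n a) \<longlonglongrightarrow> p1"
  obtains g g1 where "sl_sol a b V' g g1" "uniform_limit {a..b} f g sequentially"
    "uniform_limit {a..b} f1 g1 sequentially"
proof -
  define E where "E = exp (2 * (K + 1) * (b - a))"
  have "convergent (\<lambda>n. 2 * (cmod (f n a) + cmod (f1 n a)) * E)"
    using p p1 unfolding convergent_def by (intro exI) (rule tendsto_intros | assumption)+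
  then have "Bseq (\<lambda>n. 2 * (cmod (f n a) + cmod (f1 n a)) * E)"
    by (rule convergent_imp_Bseq)
  then obtain M where M': "\<And>n. norm (2 * (cmod (f n a) + cmod (f1 n a)) * E) \<le> M"
    by (elim BseqE) blast
  have M: "2 * (cmod (f n a) + cmod (f1 n a)) * E \<le> M" for n
    using order_trans[OF abs_ge_self M'[of n, unfolded real_norm_def]] .
  have bound: "cmod (f n x) \<le> M" if "x \<in> {a..b}" for n x
    using sl_sol_bound[OF sol[of n] K that] M[of n] norm_ge_zero[of "f1 n x"]
    unfolding E_def by linarith
  \<comment> \<open>\<open>s n\<close> measures the distance of the \<open>n\<close>-th data and
    potential from the limiting ones; two members of the sequence are compared through that
    limit.\<close>
  define s where "s = (\<lambda>n. cmod (f n a - p) + cmod (f1 n a - p1) + \<delta> n * M * (b - a))"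
  have "s \<longlonglongrightarrow> cmod (p - p) + cmod (p1 - p1) + 0 * M * (b - a)"
    unfolding s_def by (intro tendsto_intros p p1 \<delta>0)
  then have s: "s \<longlonglongrightarrow> 0"
    by simp
  have diff: "cmod (f m x - f n x) + cmod (f1 m x - f1 n x) \<le> 2 * E * (s m + s n)"
    if x: "x \<in> {a..b}" for m n x
  proof -
    have VV: "\<bar>V m z - V n z\<bar> \<le> \<delta> m + \<delta> n" if "z \<in> {a..b}" for z
      using \<delta>[OF that, of m] \<delta>[OF that, of n] by linarith
    have "cmod (f m x - f n x) + cmod (f1 m x - f1 n x)
        \<le> 2 * (cmod (f m a - f n a) + cmod (f1 m a - f1 n a) + (\<delta> m + \<delta> n) * M * (b - a)) * E"
      unfolding E_def by (rule sl_sol_diff_bound[OF sol sol K VV bound x])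
    also have "\<dots> \<le> 2 * (s m + s n) * E"
    proof -
      have "cmod (f m a - f n a) \<le> cmod (f m a - p) + cmod (f n a - p)"
        "cmod (f1 m a - f1 n a) \<le> cmod (f1 m a - p1) + cmod (f1 n a - p1)"
        using dist_triangle2[of "f m a" "f n a" p] dist_triangle2[of "f1 m a" "f1 n a" p1]
        by (simp_all add: dist_norm)
      then show ?thesis
        unfolding s_def E_def by (intro mult_right_mono) (simp_all add: distrib_right)
    qed
    finally show ?thesis
      by (simp add: mult_ac)
  qed
  have ev: "\<exists>N. \<forall>m\<ge>N. \<forall>n\<ge>N. 2 * E * (s m + s n) < e" if "e > 0" for e
  proof -
    have "(\<lambda>n. 2 * E * s n) \<longlonglongrightarrow> 2 * E * 0"
      by (intro tendsto_intros s)
    then have "\<forall>\<^sub>F n in sequentially. 2 * E * s n < e / 2"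
      using that by (intro order_tendstoD(2)) auto
    then obtain N where N: "\<And>n. n \<ge> N \<Longrightarrow> 2 * E * s n < e / 2"
      by (auto simp: eventually_sequentially)
    have "2 * E * (s m + s n) < e" if "m \<ge> N" "n \<ge> N" for m n
      using N[OF that(1)] N[OF that(2)] by (simp add: algebra_simps)
    then show ?thesis
      by blast
  qed
  have "uniformly_Cauchy_on {a..b} f"
  proof (rule uniformly_Cauchy_onI')
    fix e :: real assume "e > 0"
    then obtain N where N: "\<And>m n. m \<ge> N \<Longrightarrow> n \<ge> N \<Longrightarrow> 2 * E * (s m + s n) < e"
      using ev by blast
    have "dist (f m x) (f n x) < e" if "x \<in> {a..b}" "m \<ge> N" "n > m" for x m n
      using diff[OF that(1), of m n] N[of m n] that norm_ge_zero[of "f1 m x - f1 n x"]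
      unfolding dist_norm by linarith
    then show "\<exists>N. \<forall>x\<in>{a..b}. \<forall>m\<ge>N. \<forall>n>m. dist (f m x) (f n x) < e"
      by blast
  qed
  then obtain g where g: "uniform_limit {a..b} f g sequentially"
    using Cauchy_uniformly_convergent uniformly_convergent_on_def by blast
  have "uniformly_Cauchy_on {a..b} f1"
  proof (rule uniformly_Cauchy_onI')
    fix e :: real assume "e > 0"
    then obtain N where N: "\<And>m n. m \<ge> N \<Longrightarrow> n \<ge> N \<Longrightarrow> 2 * E * (s m + s n) < e"
      using ev by blast
    have "dist (f1 m x) (f1 n x) < e" if "x \<in> {a..b}" "m \<ge> N" "n > m" for x m n
      using diff[OF that(1), of m n] N[of m n] that norm_ge_zero[of "f m x - f n x"]
      unfolding dist_norm by linarith
    then show "\<exists>N. \<forall>x\<in>{a..b}. \<forall>m\<ge>N. \<forall>n>m. dist (f1 m x) (f1 n x) < e"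
      by blast
  qed
  then obtain g1 where g1: "uniform_limit {a..b} f1 g1 sequentially"
    using Cauchy_uniformly_convergent uniformly_convergent_on_def by blast
  have lim: "(\<lambda>n. f n x) \<longlonglongrightarrow> g x" "(\<lambda>n. f1 n x) \<longlonglongrightarrow> g1 x" if "x \<in> {a..b}" for x
    using tendsto_uniform_limitI[OF g that] tendsto_uniform_limitI[OF g1 that] .
  have sub: "{a..x} \<subseteq> {a..b}" if "x \<in> {a..b}" for x
    using that by auto
  have a_in: "a \<in> {a..b}"
    using ab by simp
  have cont_g1: "continuous_on {a..b} g1"
    by (rule uniform_limit_theorem[OF always_eventually g1])
      (simp_all add: sl_sol_continuous_deriv[OF sol])
  have int_g1: "(g1 has_integral g x - g a) {a..x}" if x: "x \<in> {a..b}" for x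
  proof (rule has_integral_uniform_limit)
    show "(f1 n has_integral f n x - f n a) {a..x}" for n
      using x by (intro sl_sol_deriv_has_integral[OF sol]) auto
    show "uniform_limit {a..x} f1 g1 sequentially"
      by (rule uniform_limit_on_subset[OF g1 sub[OF x]])
    show "(\<lambda>n. f n x - f n a) \<longlonglongrightarrow> g x - g a"
      by (rule tendsto_diff[OF lim(1)[OF x] lim(1)[OF a_in]])
  qed (use x in auto)
  have Vg: "uniform_limit {a..b} (\<lambda>n x. of_real (V n x) * f n x) (\<lambda>x. of_real (V' x) * g x) sequentially"
  proof (rule uniform_lim_mult)
    show "uniform_limit {a..b} (\<lambda>n x. complex_of_real (V n x)) (\<lambda>x. of_real (V' x)) sequentially"
    proof (rule uniform_limitI)
      fix e :: real assume "e > 0"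
      then have "\<forall>\<^sub>F n in sequentially. \<delta> n < e"
        using \<delta>0 by (intro order_tendstoD(2)) auto
      then show "\<forall>\<^sub>F n in sequentially. \<forall>x\<in>{a..b}. dist (complex_of_real (V n x)) (of_real (V' x)) < e"
      proof eventually_elim
        case (elim n)
        have "dist (complex_of_real (V n x)) (of_real (V' x)) < e" if "x \<in> {a..b}" for x
          using \<delta>[OF that, of n] elim unfolding dist_norm of_real_diff[symmetric] norm_of_real by linarith
        then show ?case
          by blast
      qed
    qed
    \<comment> \<open>Products of uniform limits need bounded limits. \<open>V'\<close> need not be
      continuous, so compactness gives no bound and one is read off from the potential with index
      0.\<close>
    have "\<bar>V' x\<bar> \<le> K + \<delta> 0" if "x \<in> {a..b}" for x
      using K[OF that, of 0] \<delta>[OF that, of 0] by linarith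
    then show "bounded ((\<lambda>x. complex_of_real (V' x)) ` {a..b})"
      unfolding bounded_iff by (intro exI[of _ "K + \<delta> 0"]) auto
    have "continuous_on {a..b} g"
      by (rule uniform_limit_theorem[OF always_eventually g])
        (simp_all add: sl_sol_continuous[OF sol])
    then show "bounded (g ` {a..b})"
      by (intro compact_imp_bounded compact_continuous_image) auto
  qed (rule g)
  have "sl_sol a b V' g g1"
    unfolding sl_sol_def
  proof (intro conjI ballI)
    fix x assume x: "x \<in> {a..b}"
    \<comment> \<open>Uniform convergence does not by itself differentiate \<open>g\<close>; the
      limit of the integrated relation does, because \<open>g1\<close> is continuous.\<close>
    have "((\<lambda>u. g a + integral {a..u} g1) has_vector_derivative g1 x) (at x within {a..b})"
      using integral_has_vector_derivative[OF cont_g1 x] by (auto intro!: derivative_eq_intros)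
    then show "(g has_vector_derivative g1 x) (at x within {a..b})"
      by (rule has_vector_derivative_transform[OF x, rotated]) (use int_g1 in \<open>auto simp: has_integral_iff\<close>)
    show "((\<lambda>s. of_real (V' s) * g s) has_integral g1 x - g1 a) {a..x}"
    proof (rule has_integral_uniform_limit)
      show "((\<lambda>s. of_real (V n s) * f n s) has_integral f1 n x - f1 n a) {a..x}" for n
        using x by (intro sl_sol_has_integral[OF sol]) auto
      show "uniform_limit {a..x} (\<lambda>n s. of_real (V n s) * f n s) (\<lambda>s. of_real (V' s) * g s) sequentially"
        by (rule uniform_limit_on_subset[OF Vg sub[OF x]])
      show "(\<lambda>n. f1 n x - f1 n a) \<longlonglongrightarrow> g1 x - g1 a"
        by (rule tendsto_diff[OF lim(2)[OF x] lim(2)[OF a_in]])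
    qed (use x in auto)
  qed
  then show ?thesis
    using g g1 by (rule that)
qed

text \<open>Here \<open>G\<close> is only Lipschitz with weak derivative \<open>g\<close>; the difference of the two sides of the
  formula over a short interval is of second order in its length, so its derivative vanishes.\<close>
lemma integration_by_parts_weak:
  fixes g G k k1 :: "real \<Rightarrow> complex"
  assumes ab: "a \<le> b"
    and g: "\<And>x y. a \<le> x \<Longrightarrow> x \<le> y \<Longrightarrow> y \<le> b \<Longrightarrow> (g has_integral G y - G x) {x..y}"
    and B: "\<And>x. x \<in> {a..b} \<Longrightarrow> cmod (g x) \<le> B"
    and k: "\<And>x. x \<in> {a..b} \<Longrightarrow> (k has_vector_derivative k1 x) (at x within {a..b})"
    and k1: "continuous_on {a..b} k1"
  shows "((\<lambda>x. g x * k x + G x * k1 x) has_integral G b * k b - G a * k a) {a..b}"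
proof -
  let ?F = "\<lambda>x. g x * k x + G x * k1 x"
  have cont_k: "continuous_on {a..b} k"
    by (auto simp: continuous_on_eq_continuous_within intro: has_vector_derivative_continuous k)
  have B0: "B \<ge> 0"
    using order_trans[OF norm_ge_zero B[of a]] ab by simp
  obtain L where L: "\<And>x. x \<in> {a..b} \<Longrightarrow> cmod (k1 x) \<le> L" and L0: "L > 0"
    using compact_imp_bounded[OF compact_continuous_image[OF k1 compact_Icc]]
    unfolding bounded_pos by blast
  have lip_k: "cmod (k y - k x) \<le> L * (y - x)" if "a \<le> x" "x \<le> y" "y \<le> b" for x y
  proof -
    have "(k1 has_integral k y - k x) {x..y}"
      using that by (intro fundamental_theorem_of_calculus)
        (auto intro: has_vector_derivative_within_subset[OF k])
    then show ?thesis
      using has_integral_bound_real[OF less_imp_le[OF L0] finite.emptyI, of k1 "k y - k x" x y] L that by simp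
  qed
  have lip_G: "cmod (G y - G x) \<le> B * (y - x)" if "a \<le> x" "x \<le> y" "y \<le> b" for x y
    using has_integral_bound_real[OF B0 finite.emptyI g[OF that]] B that by simp
  have cont_G: "continuous_on {a..b} G"
  proof -
    have "continuous_on {a..b} (\<lambda>x. G a + integral {a..x} g)"
      using g[of a b] ab by (intro continuous_intros indefinite_integral_continuous_1) auto
    then show ?thesis
    proof (rule continuous_on_eq)
      fix x assume "x \<in> {a..b}"
      then show "G a + integral {a..x} g = G x"
        using integral_unique[OF g[of a x]] by simp
    qed
  qed
  have abs_g: "g absolutely_integrable_on {a..b}"
    using g[of a b] ab B by (intro absolutely_integrable_integrable_bound[of _ g "\<lambda>_. B"]) auto
  have "(\<lambda>x. k x * g x) absolutely_integrable_on {a..b}"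
  proof (rule absolutely_integrable_bounded_measurable_product[where h = "(*)" and f = k, OF _ _ _ _ abs_g])
    show "bilinear ((*) :: complex \<Rightarrow> _)"
      by (simp add: bilinear_conv_bounded_bilinear bounded_bilinear_mult)
    show "k \<in> borel_measurable (lebesgue_on {a..b})"
      by (intro continuous_imp_measurable_on_sets_lebesgue cont_k) auto
    show "bounded (k ` {a..b})"
      by (intro compact_imp_bounded compact_continuous_image cont_k) auto
  qed auto
  then have int_gk: "(\<lambda>x. g x * k x) integrable_on {a..b}"
    by (simp add: mult.commute set_lebesgue_integral_eq_integral)
  have int_F: "?F integrable_on {a..b}"
    by (rule integrable_add[OF int_gk integrable_continuous_real]) (intro continuous_intros cont_G k1)
  define D where "D = (\<lambda>x. G x * k x - integral {a..x} ?F)"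
  have D_le: "cmod (D y - D x) \<le> 2 * B * L * (y - x)\<^sup>2" if xy: "a \<le> x" "x \<le> y" "y \<le> b" for x y
  proof -
    have comb: "integral {a..x} ?F + integral {x..y} ?F = integral {a..y} ?F"
      using xy by (intro Henstock_Kurzweil_Integration.integral_combine integrable_on_subinterval[OF int_F]) auto
    have "(?F has_integral integral {x..y} ?F) {x..y}"
      using xy by (intro integrable_integral integrable_on_subinterval[OF int_F]) auto
    then have F: "(?F has_integral integral {a..y} ?F - integral {a..x} ?F) {x..y}"
      unfolding comb[symmetric] by simp
    have "(k1 has_integral k y - k x) {x..y}"
      using xy by (intro fundamental_theorem_of_calculus)
        (auto intro: has_vector_derivative_within_subset[OF k])
    \<comment> \<open>The discrete product rule \<open>(G y - G x) k x + G y (k y - k x)\<close>.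
      Freezing \<open>k\<close> at the left end and \<open>G\<close> at the right end leaves an
      integrand in which every term has a factor of the order of \<open>y - x\<close>.\<close>
    from has_integral_diff[OF has_integral_add[OF has_integral_mult_left[OF g[OF xy], of "k x"]
          has_integral_mult_right[OF this, of "G y"]] F]
    have "((\<lambda>s. g s * (k x - k s) + (G y - G s) * k1 s) has_integral D y - D x) {x..y}"
      by (simp add: D_def algebra_simps)
    moreover have "cmod (g s * (k x - k s) + (G y - G s) * k1 s) \<le> 2 * B * L * (y - x)" if s: "s \<in> {x..y}" for s
    proof -
      have "cmod (g s * (k x - k s) + (G y - G s) * k1 s)
          \<le> cmod (g s) * cmod (k s - k x) + cmod (G y - G s) * cmod (k1 s)"
        by (rule norm_triangle_le) (simp add: norm_mult norm_minus_commute)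
      also have "\<dots> \<le> B * (L * (s - x)) + B * (y - s) * L"
        using xy s B0 L0 by (intro add_mono mult_mono B L lip_k lip_G) auto
      also have "\<dots> = B * L * (y - x)"
        by (simp add: algebra_simps)
      also have "\<dots> \<le> 2 * B * L * (y - x)"
        using B0 L0 xy by (simp add: mult_nonneg_nonneg)
      finally show ?thesis .
    qed
    ultimately have "cmod (D y - D x) \<le> 2 * B * L * (y - x) * measure lborel {x..y}"
      using B0 L0 xy by (intro has_integral_bound_real[where S = "{}"]) auto
    then show ?thesis
      using xy by (simp add: power2_eq_square mult.assoc)
  qed
  have "(D has_derivative (\<lambda>_. 0)) (at x within {a..b})" if x: "x \<in> {a..b}" for x
  proof (rule has_derivativeI_sandwich[of 1])
    show "norm (D y - D x - 0) / norm (y - x) \<le> 2 * B * L * \<bar>y - x\<bar>"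
      if "y \<in> {a..b}" "y \<noteq> x" for y
    proof -
      have "cmod (D y - D x) \<le> 2 * B * L * (y - x)\<^sup>2"
        using D_le[of x y] D_le[of y x] x that by (cases "x \<le> y") (auto simp: norm_minus_commute power2_commute)
      then show ?thesis
        using that unfolding power2_eq_square abs_mult_self_eq[of "y - x", symmetric]
        by (simp add: pos_divide_le_eq mult.assoc del: abs_mult_self_eq)
    qed
    have "((\<lambda>y. 2 * B * L * \<bar>y - x\<bar>) \<longlongrightarrow> 2 * B * L * \<bar>x - x\<bar>) (at x within {a..b})"
      by (intro tendsto_intros)
    then show "((\<lambda>y. 2 * B * L * \<bar>y - x\<bar>) \<longlongrightarrow> 0) (at x within {a..b})"
      by simp
  qed auto
  then obtain c where c: "\<And>x. x \<in> {a..b} \<Longrightarrow> D x = c"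
    using has_derivative_zero_constant[of "{a..b}" D] by auto
  have "D b = D a"
    using c[of a] c[of b] ab by simp
  then have "integral {a..b} ?F = G b * k b - G a * k a"
    by (simp add: D_def algebra_simps)
  with int_F show ?thesis
    by (simp add: has_integral_iff)
qed

text \<open>As the potentials are real, \<open>cnj h\<close> solves the same equation as
  \<open>h\<close>. Integrating \<open>f1 cnj h\<close> and \<open>cnj h1 f\<close> by parts and
  subtracting, the terms with both first derivatives cancel.\<close>

lemma sl_sol_lagrange:
  assumes ab: "a \<le> b" and f: "sl_sol a b V f f1" and h: "sl_sol a b W h h1"
    and V: "\<And>x. x \<in> {a..b} \<Longrightarrow> \<bar>V x\<bar> \<le> K" and W: "\<And>x. x \<in> {a..b} \<Longrightarrow> \<bar>W x\<bar> \<le> K"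
  shows "((\<lambda>x. of_real (V x - W x) * (f x * cnj (h x))) has_integral
    (f1 b * cnj (h b) - f b * cnj (h1 b)) - (f1 a * cnj (h a) - f a * cnj (h1 a))) {a..b}"
proof -
  have bd: "\<exists>M. \<forall>x\<in>{a..b}. cmod (of_real (U x) * g x) \<le> M"
    if sol: "sl_sol a b U g g1" and U: "\<And>x. x \<in> {a..b} \<Longrightarrow> \<bar>U x\<bar> \<le> K" for U g g1
  proof -
    obtain M where M: "\<And>x. x \<in> {a..b} \<Longrightarrow> cmod (g x) \<le> M"
      using compact_imp_bounded[OF compact_continuous_image[OF sl_sol_continuous[OF sol] compact_Icc]]
      unfolding bounded_iff by blast
    have "cmod (of_real (U x) * g x) \<le> K * M" if "x \<in> {a..b}" for x
      using U[OF that] M[OF that] by (auto simp: norm_mult intro!: mult_mono)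
    then show ?thesis
      by blast
  qed
  note h' = sl_sol_cnj[OF h]
  obtain M1 where M1: "\<And>x. x \<in> {a..b} \<Longrightarrow> cmod (of_real (V x) * f x) \<le> M1"
    using bd[OF f V] by blast
  obtain M2 where M2: "\<And>x. x \<in> {a..b} \<Longrightarrow> cmod (of_real (W x) * cnj (h x)) \<le> M2"
    using bd[OF h' W] by blast
  from has_integral_diff[OF
      integration_by_parts_weak[OF ab sl_sol_has_integral[OF f] M1 sl_sol_deriv[OF h'] sl_sol_continuous_deriv[OF h']]
      integration_by_parts_weak[OF ab sl_sol_has_integral[OF h'] M2 sl_sol_deriv[OF f] sl_sol_continuous_deriv[OF f]]]
  show ?thesis
    by (simp add: algebra_simps)
qed

text \<open>Gronwall needs a bound at every point, whereas the potential is bounded only almost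
  everywhere; truncation changes it only on a null set of the edge.\<close>

lemma bounded_representative:
  fixes q :: "real \<Rightarrow> real"
  assumes "set_borel_measurable lborel X q" and "\<exists>C. AE x in lborel. x \<in> X \<longrightarrow> \<bar>q x\<bar> \<le> C"
  obtains Q C where "Q \<in> borel_measurable borel" "\<And>x. \<bar>Q x\<bar> \<le> C"
    "AE x in lborel. x \<in> X \<longrightarrow> q x = Q x"
proof -
  obtain C where C: "AE x in lborel. x \<in> X \<longrightarrow> \<bar>q x\<bar> \<le> C"
    using assms(2) by blast
  define r where "r = (\<lambda>x. indicator X x *\<^sub>R q x)"
  have r: "r \<in> borel_measurable borel"
    using assms(1) by (simp add: set_borel_measurable_def r_def)
  define Q where "Q = (\<lambda>x. max (- \<bar>C\<bar>) (min \<bar>C\<bar> (r x)))"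
  show ?thesis
  proof
    show "Q \<in> borel_measurable borel"
      unfolding Q_def using r by measurable
    show "\<bar>Q x\<bar> \<le> \<bar>C\<bar>" for x
      by (auto simp: Q_def)
    show "AE x in lborel. x \<in> X \<longrightarrow> q x = Q x"
      using C by eventually_elim (auto simp: Q_def r_def)
  qed
qed

lemma set_integrable_lborel_Icc_if_bounded:
  fixes g :: "real \<Rightarrow> 'a::{banach, second_countable_topology}"
  assumes "set_borel_measurable lborel {a..b} g" and "\<And>x. x \<in> {a..b} \<Longrightarrow> norm (g x) \<le> B"
  shows "set_integrable lborel {a..b} g"
proof -
  have "integrable lborel (\<lambda>x. indicator {a..b} x *\<^sub>R (indicator {a..b} x *\<^sub>R g x))"
    using assms by (intro integrableI_bounded_set_indicator[where B = B])
      (auto simp: set_borel_measurable_def emeasure_lborel_Icc_eq)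
  then show ?thesis
    by (simp add: set_integrable_def flip: indicator_inter_arith)
qed

lemma has_integral_AE_cong:
  fixes f g :: "real \<Rightarrow> 'a::banach"
  assumes "AE x in lborel. x \<in> S \<longrightarrow> f x = g x" and "(f has_integral i) S"
  shows "(g has_integral i) S"
proof -
  obtain N where N: "N \<in> null_sets lborel" "{x. \<not> (x \<in> S \<longrightarrow> f x = g x)} \<subseteq> N"
    using assms(1) unfolding eventually_ae_filter by auto
  then have "negligible N"
    by (simp add: negligible_iff_null_sets null_sets_completionI)
  then show ?thesis
    by (rule has_integral_spike[OF _ _ assms(2)]) (use N in auto)
qed

text \<open>The weak second derivative agrees with \<open>(Q - mu) f\<close> almost everywhere,
  which the integral of the definition cannot distinguish; the Lebesgue integral there is read as a
  gauge integral.\<close>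

lemma H2_edge_imp_sl_sol:
  assumes "H2_edge a b f g"
    and eq: "AE x in lborel. x \<in> {a..b} \<longrightarrow> - g x + of_real (q x) * f x = of_real \<mu> * f x"
    and qQ: "AE x in lborel. x \<in> {a..b} \<longrightarrow> q x = Q x"
  shows "\<exists>f1. sl_sol a b (\<lambda>x. Q x - \<mu>) f f1"
proof -
  obtain f1 where int: "set_integrable lborel {a..b} g"
      and f1: "\<forall>x\<in>{a..b}. (f has_vector_derivative f1 x) (at x within {a..b})"
      and g: "\<forall>x\<in>{a..b}. f1 x = f1 a + (LINT y:{a..x}|lborel. g y)"
    using assms(1) unfolding H2_edge_def by blast
  have "((\<lambda>s. of_real (Q s - \<mu>) * f s) has_integral f1 x - f1 a) {a..x}" if x: "x \<in> {a..b}" for x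
  proof (rule has_integral_AE_cong)
    show "AE s in lborel. s \<in> {a..x} \<longrightarrow> g s = of_real (Q s - \<mu>) * f s"
      using eq qQ
    proof eventually_elim
      case (elim s)
      show ?case
      proof
        assume "s \<in> {a..x}"
        then have s: "s \<in> {a..b}"
          using x by simp
        have "g s = of_real (q s) * f s - (- g s + of_real (q s) * f s)"
          by simp
        also have "\<dots> = of_real (q s) * f s - of_real \<mu> * f s"
          using elim(1) s by simp
        also have "\<dots> = of_real (Q s - \<mu>) * f s"
          using elim(2) s by (simp add: left_diff_distrib)
        finally show "g s = of_real (Q s - \<mu>) * f s" .
      qed
    qed
    have "set_integrable lborel {a..x} g"
      by (rule set_integrable_subset[OF int]) (use x in auto)
    from set_borel_integral_eq_integral[OF this] g[rule_format, OF x]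
    show "(g has_integral f1 x - f1 a) {a..x}"
      by (simp add: has_integral_iff)
  qed
  with f1 show ?thesis
    unfolding sl_sol_def by blast
qed

text \<open>The direction needed for limits: simplicity speaks of \<open>in_eigenspace\<close>, so a
  limit function obtained from the integrated equation must be returned to the weak
  formulation.\<close>

lemma sl_sol_imp_H2_edge:
  assumes sol: "sl_sol a b (\<lambda>x. Q x - \<mu>) f f1"
    and Q: "Q \<in> borel_measurable borel" and C: "\<And>x. \<bar>Q x\<bar> \<le> C"
    and qQ: "AE x in lborel. x \<in> {a..b} \<longrightarrow> q x = Q x"
  shows "\<exists>g. H2_edge a b f g \<and>
    (AE x in lborel. x \<in> {a..b} \<longrightarrow> - g x + of_real (q x) * f x = of_real \<mu> * f x)"
proof (intro exI conjI)
  let ?g = "\<lambda>x. of_real (Q x - \<mu>) * f x"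
  have cont: "continuous_on {a..b} f"
    by (rule sl_sol_continuous[OF sol])
  have "(\<lambda>x. indicator {a..b} x *\<^sub>R f x) \<in> borel_measurable borel"
    by (intro borel_measurable_continuous_on_indicator cont) auto
  then have "(\<lambda>x. of_real (Q x - \<mu>) * (indicator {a..b} x *\<^sub>R f x)) \<in> borel_measurable borel"
    using Q by measurable
  then have meas: "set_borel_measurable lborel {a..b} ?g"
    by (simp add: set_borel_measurable_def)
  then have "(\<lambda>x. (cmod (indicator {a..b} x *\<^sub>R ?g x))\<^sup>2) \<in> borel_measurable lborel"
    unfolding set_borel_measurable_def by measurable
  also have "(\<lambda>x. (cmod (indicator {a..b} x *\<^sub>R ?g x))\<^sup>2) = (\<lambda>x. indicator {a..b} x *\<^sub>R (cmod (?g x))\<^sup>2)"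
    by (auto simp: indicator_def)
  finally have meas2: "set_borel_measurable lborel {a..b} (\<lambda>x. (cmod (?g x))\<^sup>2)"
    by (simp add: set_borel_measurable_def)
  obtain M where M: "\<And>x. x \<in> {a..b} \<Longrightarrow> cmod (f x) \<le> M"
    using compact_imp_bounded[OF compact_continuous_image[OF cont compact_Icc]]
    unfolding bounded_iff by blast
  have bound: "cmod (?g x) \<le> (C + \<bar>\<mu>\<bar>) * M" if "x \<in> {a..b}" for x
    unfolding norm_mult norm_of_real
    using C[of x] M[OF that] abs_ge_zero[of "Q x"] norm_ge_zero[of "f x"] by (intro mult_mono) linarith+
  have int: "set_integrable lborel {a..b} ?g"
    by (rule set_integrable_lborel_Icc_if_bounded[OF meas bound])
  have int2: "set_integrable lborel {a..b} (\<lambda>x. (cmod (?g x))\<^sup>2)"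
    by (rule set_integrable_lborel_Icc_if_bounded[OF meas2, of "((C + \<bar>\<mu>\<bar>) * M)\<^sup>2"])
      (use bound in \<open>simp add: power_mono\<close>)
  have "f1 x = f1 a + (LINT y:{a..x}|lborel. ?g y)" if x: "x \<in> {a..b}" for x
  proof -
    have "set_integrable lborel {a..x} ?g"
      by (rule set_integrable_subset[OF int]) (use x in auto)
    moreover have "(?g has_integral f1 x - f1 a) {a..x}"
      using sl_sol_has_integral[OF sol, of a x] x by simp
    ultimately show ?thesis
      by (simp add: set_borel_integral_eq_integral(2) integral_unique)
  qed
  then show "H2_edge a b f ?g"
    unfolding H2_edge_def using meas int int2 sl_sol_deriv[OF sol] by blast
  show "AE x in lborel. x \<in> {a..b} \<longrightarrow> - ?g x + of_real (q x) * f x = of_real \<mu> * f x"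
    using qQ by eventually_elim (simp add: algebra_simps)
qed

section \<open>Compactness of eigenfunctions and the eigenvalue derivative\<close>

text \<open>Compactness yields limits only along subsequences; since the limit of the quotients is
  always the same, convergence of the whole sequence follows.\<close>

lemma tendsto_if_subsequences_tendsto:
  fixes f :: "nat \<Rightarrow> 'a::metric_space"
  assumes sub: "\<And>r :: nat \<Rightarrow> nat. strict_mono r \<Longrightarrow> \<exists>s :: nat \<Rightarrow> nat. strict_mono s \<and> (\<lambda>n. f (r (s n))) \<longlonglongrightarrow> l"
  shows "f \<longlonglongrightarrow> l"
proof (rule ccontr)
  assume "\<not> f \<longlonglongrightarrow> l"
  then obtain e where e: "e > 0" and "\<exists>\<^sub>F n in sequentially. \<not> dist (f n) l < e"
    by (auto simp: tendsto_iff not_eventually)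
  then have "infinite {n. \<not> dist (f n) l < e}"
    by (simp add: cofinite_eq_sequentially[symmetric] frequently_cofinite)
  then obtain r :: "nat \<Rightarrow> nat" where r: "strict_mono r" "\<And>n. \<not> dist (f (r n)) l < e"
    using infinite_enumerate by blast
  then obtain s :: "nat \<Rightarrow> nat" where "(\<lambda>n. f (r (s n))) \<longlonglongrightarrow> l"
    using sub by blast
  then have "\<forall>\<^sub>F n in sequentially. dist (f (r (s n))) l < e"
    using e by (rule tendstoD)
  then show False
    using r(2) by (auto dest: eventually_happens)
qed

lemma sum_edge_ends:
  "(\<Sum>p\<in>UNIV. F p) = (\<Sum>e\<in>UNIV. F (e, False) + F (e, True))" for F :: "'e::finite \<times> bool \<Rightarrow> 'a::comm_monoid_add"
  by (simp add: sum.cartesian_product' UNIV_Times_UNIV[symmetric] UNIV_bool del: UNIV_Times_UNIV)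

text \<open>\<open>gammaN\<close> with the derivative as an explicit argument. It agrees with
  \<open>gammaN\<close> on solutions (\<open>gammaN_eq\<close>) and, unlike
  \<open>vector_derivative\<close>, passes directly to uniform limits of \<open>f1\<close>.\<close>

definition inward_derivs :: "('e \<Rightarrow> real) \<Rightarrow> ('e \<Rightarrow> real) \<Rightarrow> ('e \<Rightarrow> real \<Rightarrow> complex) \<Rightarrow> complex ^ ('e::finite \<times> bool)" where
  "inward_derivs a b f1 = (\<chi> p. case p of (e, s) \<Rightarrow> if s then - f1 e (b e) else f1 e (a e))"

text \<open>These data at the left ends determine a solution and live in a finite-dimensional space,
  whose unit sphere is compact.\<close>

definition initial_data :: "('e \<Rightarrow> real) \<Rightarrow> ('e \<Rightarrow> real \<Rightarrow> complex) \<Rightarrow> ('e \<Rightarrow> real \<Rightarrow> complex)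
    \<Rightarrow> (complex \<times> complex) ^ 'e::finite" where
  "initial_data a f f1 = (\<chi> e. (f e (a e), f1 e (a e)))"

definition edge_inner :: "('e::finite \<Rightarrow> real) \<Rightarrow> ('e \<Rightarrow> real) \<Rightarrow> ('e \<Rightarrow> real \<Rightarrow> complex)
    \<Rightarrow> ('e \<Rightarrow> real \<Rightarrow> complex) \<Rightarrow> complex" where
  "edge_inner a b f h = (\<Sum>e\<in>UNIV. integral {a e..b e} (\<lambda>x. f e x * cnj (h e x)))"

section \<open>Solutions on all edges together, before any vertex condition\<close>

locale sl_graph =
  fixes a b :: "'e::finite \<Rightarrow> real" and Q :: "'e \<Rightarrow> real \<Rightarrow> real" and C :: "'e \<Rightarrow> real"
  assumes edges: "a e < b e"
    and Q_bound: "\<bar>Q e x\<bar> \<le> C e"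
begin

definition graph_sol :: "real \<Rightarrow> ('e \<Rightarrow> real \<Rightarrow> complex) \<Rightarrow> ('e \<Rightarrow> real \<Rightarrow> complex) \<Rightarrow> bool" where
  "graph_sol \<mu> f f1 \<longleftrightarrow> (\<forall>e. sl_sol (a e) (b e) (\<lambda>x. Q e x - \<mu>) (f e) (f1 e))"

lemma graph_solD: "graph_sol \<mu> f f1 \<Longrightarrow> sl_sol (a e) (b e) (\<lambda>x. Q e x - \<mu>) (f e) (f1 e)"
  by (simp add: graph_sol_def)

lemma potential_bound: "\<bar>Q e x - \<mu>\<bar> \<le> C e + \<bar>\<mu>\<bar>"
  using Q_bound[of e x] by linarith

lemma gammaN_eq:
  assumes "graph_sol \<mu> f f1"
  shows "gammaN a b f = inward_derivs a b f1"
proof -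
  have "vector_derivative (f e) (at x within {a e..b e}) = f1 e x" if "x \<in> {a e..b e}" for e x
    using vector_derivative_within_cbox[OF edges[of e]] sl_sol_deriv[OF graph_solD[OF assms] that] that
    by simp
  then show ?thesis
    using edges by (auto simp: gammaN_def inward_derivs_def vec_eq_iff less_imp_le)
qed

text \<open>The inward derivative at \<open>b e\<close> is \<open>- f1\<close>, so each edge
  contributes minus the increment of \<open>W\<close>, while the Lagrange identity has the factor
  \<open>(Q - \<mu>) - (Q - \<nu>) = \<nu> - \<mu>\<close>. The two signs combine to
  \<open>\<mu> - \<nu>\<close>.\<close>

lemma green_identity:
  assumes f: "graph_sol \<mu> f f1" and h: "graph_sol \<nu> h h1"
  shows "omega (Tr a b f) (Tr a b h) = of_real (\<mu> - \<nu>) * edge_inner a b f h"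
proof -
  define W where "W = (\<lambda>e x. f1 e x * cnj (h e x) - f e x * cnj (h1 e x))"
  have "W e (b e) - W e (a e) = of_real (\<nu> - \<mu>) * integral {a e..b e} (\<lambda>x. f e x * cnj (h e x))" for e
  proof -
    have "((\<lambda>x. of_real ((Q e x - \<mu>) - (Q e x - \<nu>)) * (f e x * cnj (h e x))) has_integral
        W e (b e) - W e (a e)) {a e..b e}"
      unfolding W_def
    proof (rule sl_sol_lagrange[OF less_imp_le[OF edges] graph_solD[OF f] graph_solD[OF h]])
      show "\<bar>Q e x - \<mu>\<bar> \<le> C e + (\<bar>\<mu>\<bar> + \<bar>\<nu>\<bar>)" "\<bar>Q e x - \<nu>\<bar> \<le> C e + (\<bar>\<mu>\<bar> + \<bar>\<nu>\<bar>)" for x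
        using potential_bound[of e x \<mu>] potential_bound[of e x \<nu>] by linarith+
    qed
    then have scaled: "((\<lambda>x. of_real (\<nu> - \<mu>) * (f e x * cnj (h e x))) has_integral
        W e (b e) - W e (a e)) {a e..b e}"
      by simp
    show ?thesis
      by (simp only: integral_unique[OF scaled, symmetric] integral_mult_right)
  qed
  then have W: "- (W e (b e) - W e (a e)) = of_real (\<mu> - \<nu>) * integral {a e..b e} (\<lambda>x. f e x * cnj (h e x))" for e
    by (simp add: algebra_simps)
  have "omega (Tr a b f) (Tr a b h) = (\<Sum>e\<in>UNIV. - (W e (b e) - W e (a e)))"
    unfolding omega_def Tr_def gammaN_eq[OF f] gammaN_eq[OF h] sum_edge_ends
    by (intro sum.cong) (simp_all add: gammaD_def inward_derivs_def W_def)
  also have "\<dots> = of_real (\<mu> - \<nu>) * edge_inner a b f h"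
    unfolding W edge_inner_def by (rule sum_distrib_left[symmetric])
  finally show ?thesis .
qed

lemma edge_inner_tendsto:
  assumes u: "\<And>e. continuous_on {a e..b e} (u e)" and h: "\<And>n e. continuous_on {a e..b e} (h n e)"
    and lim: "\<And>e. uniform_limit {a e..b e} (\<lambda>n. h n e) (g e) sequentially"
  shows "(\<lambda>n. edge_inner a b u (h n)) \<longlonglongrightarrow> edge_inner a b u g"
  unfolding edge_inner_def
proof (rule tendsto_sum)
  fix e
  have "uniform_limit {a e..b e} (\<lambda>n x. u e x * cnj (h n e x)) (\<lambda>x. u e x * cnj (g e x)) sequentially"
  proof (rule uniform_lim_mult)
    show "uniform_limit {a e..b e} (\<lambda>n x. cnj (h n e x)) (\<lambda>x. cnj (g e x)) sequentially"
      by (rule bounded_linear.uniform_limit[OF bounded_linear_cnj lim])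
    show "bounded (u e ` {a e..b e})"
      by (intro compact_imp_bounded compact_continuous_image u) auto
    have "continuous_on {a e..b e} (g e)"
      by (rule uniform_limit_theorem[OF always_eventually lim]) (simp_all add: h)
    then show "bounded ((\<lambda>x. cnj (g e x)) ` {a e..b e})"
      by (intro compact_imp_bounded compact_continuous_image continuous_on_cnj) auto
  qed (simp add: uniform_limit_const)
  then obtain I J where I: "\<And>n. ((\<lambda>x. u e x * cnj (h n e x)) has_integral I n) {a e..b e}"
      and J: "((\<lambda>x. u e x * cnj (g e x)) has_integral J) {a e..b e}" "I \<longlonglongrightarrow> J"
    by (rule uniform_limit_integral) (auto intro!: continuous_intros u h)
  then show "(\<lambda>n. integral {a e..b e} (\<lambda>x. u e x * cnj (h n e x)))
      \<longlonglongrightarrow> integral {a e..b e} (\<lambda>x. u e x * cnj (g e x))"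
    using integral_unique[OF I] integral_unique[OF J(1)] by simp
qed

lemma edge_inner_self:
  assumes u: "\<And>e. continuous_on {a e..b e} (u e)"
  shows "edge_inner a b u u = of_real (L2norm_sq a b u)"
proof -
  have "integral {a e..b e} (\<lambda>x. u e x * cnj (u e x))
      = of_real (LINT x:{a e..b e}|lborel. (cmod (u e x))\<^sup>2)" for e
  proof -
    have "set_integrable lborel {a e..b e} (\<lambda>x. (cmod (u e x))\<^sup>2)"
      by (intro borel_integrable_atLeastAtMost' continuous_intros u)
    from set_borel_integral_eq_integral[OF this]
    have "((\<lambda>x. (cmod (u e x))\<^sup>2) has_integral (LINT x:{a e..b e}|lborel. (cmod (u e x))\<^sup>2)) {a e..b e}"
      by (simp add: has_integral_iff)
    from has_integral_linear[OF this bounded_linear_of_real[where 'a = complex]]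
    have "((\<lambda>x. u e x * cnj (u e x)) has_integral
        of_real (LINT x:{a e..b e}|lborel. (cmod (u e x))\<^sup>2)) {a e..b e}"
      by (simp add: o_def complex_norm_square del: of_real_power)
    then show ?thesis
      by (rule integral_unique)
  qed
  then show ?thesis
    by (simp add: edge_inner_def L2norm_sq_def)
qed

lemma zero_if_initial_data_zero:
  assumes sol: "graph_sol \<mu> f f1" and "initial_data a f f1 = 0" and x: "x \<in> {a e..b e}"
  shows "f e x = 0"
proof -
  have "f e (a e) = 0" "f1 e (a e) = 0"
    using assms(2) by (auto simp: initial_data_def vec_eq_iff zero_prod_def)
  then have "cmod (f e x) + cmod (f1 e x) \<le> 0"
    using sl_sol_bound[OF graph_solD[OF sol] potential_bound x] by simp
  then show ?thesis
    using norm_ge_zero[of "f1 e x"] norm_le_zero_iff[of "f e x"] by linarith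
qed

lemma graph_sol_scale: "graph_sol \<mu> f f1 \<Longrightarrow> graph_sol \<mu> (\<lambda>e x. c * f e x) (\<lambda>e x. c * f1 e x)"
  by (simp add: graph_sol_def sl_sol_scale)

lemma traces_scale:
  "gammaD a b (\<lambda>e x. c * f e x) = c *s gammaD a b f"
  "inward_derivs a b (\<lambda>e x. c * f e x) = c *s inward_derivs a b f"
  by (auto simp: gammaD_def inward_derivs_def vec_eq_iff)

text \<open>A single extraction in the unit sphere of initial data serves all edges at once. The
  limit keeps norm 1, so it cannot degenerate to zero.\<close>

lemma graph_sol_compact:
  fixes f f1 :: "nat \<Rightarrow> 'e \<Rightarrow> real \<Rightarrow> complex"
  assumes sol: "\<And>n. graph_sol (\<mu> n) (f n) (f1 n)" and \<mu>: "\<mu> \<longlonglongrightarrow> \<mu>0"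
    and norm1: "\<And>n. norm (initial_data a (f n) (f1 n)) = 1"
  obtains r g g1 where "strict_mono (r :: nat \<Rightarrow> nat)" "graph_sol \<mu>0 g g1"
    "norm (initial_data a g g1) = 1"
    "\<And>e. uniform_limit {a e..b e} (\<lambda>n. f (r n) e) (g e) sequentially"
    "\<And>e. uniform_limit {a e..b e} (\<lambda>n. f1 (r n) e) (g1 e) sequentially"
proof -
  have "compact (sphere (0 :: (complex \<times> complex) ^ 'e) 1)"
    by simp
  then obtain l r where r: "strict_mono (r :: nat \<Rightarrow> nat)" and l: "norm l = 1"
      and lim: "(\<lambda>n. initial_data a (f (r n)) (f1 (r n))) \<longlonglongrightarrow> l"
    unfolding compact_def
    by (elim allE[of _ "\<lambda>n. initial_data a (f n) (f1 n)"]) (auto simp: norm1 o_def)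
  obtain M where M: "\<And>n. \<bar>\<mu> n\<bar> \<le> M"
    using convergent_imp_Bseq[of \<mu>] \<mu> by (auto simp: convergent_def Bseq_def)
  have ex: "\<forall>e. \<exists>g g1. sl_sol (a e) (b e) (\<lambda>x. Q e x - \<mu>0) g g1 \<and>
      uniform_limit {a e..b e} (\<lambda>n. f (r n) e) g sequentially \<and>
      uniform_limit {a e..b e} (\<lambda>n. f1 (r n) e) g1 sequentially"
  proof
    fix e
    have V: "\<bar>Q e x - \<mu> (r n)\<bar> \<le> C e + M" for n x
      using potential_bound[of e x "\<mu> (r n)"] M[of "r n"] by linarith
    have \<delta>: "\<bar>(Q e x - \<mu> (r n)) - (Q e x - \<mu>0)\<bar> \<le> \<bar>\<mu> (r n) - \<mu>0\<bar>" for n x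
      by linarith
    have "(\<lambda>n. \<bar>\<mu> (r n) - \<mu>0\<bar>) \<longlonglongrightarrow> \<bar>\<mu>0 - \<mu>0\<bar>"
      using LIMSEQ_subseq_LIMSEQ[OF \<mu> r] by (intro tendsto_intros) (simp add: o_def)
    then have \<delta>0: "(\<lambda>n. \<bar>\<mu> (r n) - \<mu>0\<bar>) \<longlonglongrightarrow> 0"
      by simp
    have le: "(\<lambda>n. (f (r n) e (a e), f1 (r n) e (a e))) \<longlonglongrightarrow> l $ e"
      using tendsto_vec_nth[OF lim, of e] by (simp add: initial_data_def)
    have p: "(\<lambda>n. f (r n) e (a e)) \<longlonglongrightarrow> fst (l $ e)" and p1: "(\<lambda>n. f1 (r n) e (a e)) \<longlonglongrightarrow> snd (l $ e)"
      using tendsto_fst[OF le] tendsto_snd[OF le] by simp_all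
    show "\<exists>g g1. sl_sol (a e) (b e) (\<lambda>x. Q e x - \<mu>0) g g1 \<and>
      uniform_limit {a e..b e} (\<lambda>n. f (r n) e) g sequentially \<and>
      uniform_limit {a e..b e} (\<lambda>n. f1 (r n) e) g1 sequentially"
      by (rule sl_sol_limit[OF edges graph_solD[OF sol] V \<delta> \<delta>0 p p1]) blast
  qed
  obtain g where "\<forall>e. \<exists>g1. sl_sol (a e) (b e) (\<lambda>x. Q e x - \<mu>0) (g e) g1 \<and>
      uniform_limit {a e..b e} (\<lambda>n. f (r n) e) (g e) sequentially \<and>
      uniform_limit {a e..b e} (\<lambda>n. f1 (r n) e) g1 sequentially"
    using choice[OF ex] by blast
  from choice[OF this] obtain g1 where sol': "\<And>e. sl_sol (a e) (b e) (\<lambda>x. Q e x - \<mu>0) (g e) (g1 e)"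
      and g: "\<And>e. uniform_limit {a e..b e} (\<lambda>n. f (r n) e) (g e) sequentially"
      and g1: "\<And>e. uniform_limit {a e..b e} (\<lambda>n. f1 (r n) e) (g1 e) sequentially"
    by blast
  have "(\<lambda>n. initial_data a (f (r n)) (f1 (r n))) \<longlonglongrightarrow> initial_data a g g1"
    unfolding initial_data_def
    by (intro tendsto_vec_lambda tendsto_Pair tendsto_uniform_limitI[OF g] tendsto_uniform_limitI[OF g1])
      (simp_all add: less_imp_le[OF edges])
  then have "initial_data a g g1 = l"
    using lim LIMSEQ_unique by blast
  then show ?thesis
    using sol' l by (intro that[OF r _ _ g g1]) (simp_all add: graph_sol_def)
qed

lemma traces_tendsto:
  assumes "\<And>e. uniform_limit {a e..b e} (\<lambda>n. f n e) (g e) sequentially"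
  shows "(\<lambda>n. gammaD a b (f n)) \<longlonglongrightarrow> gammaD a b g"
    and "(\<lambda>n. inward_derivs a b (f n)) \<longlonglongrightarrow> inward_derivs a b g"
proof -
  have "(\<lambda>n. f n e (a e)) \<longlonglongrightarrow> g e (a e)" "(\<lambda>n. f n e (b e)) \<longlonglongrightarrow> g e (b e)" for e
    using edges[of e] by (auto intro!: tendsto_uniform_limitI[OF assms])
  then show "(\<lambda>n. gammaD a b (f n)) \<longlonglongrightarrow> gammaD a b g"
    and "(\<lambda>n. inward_derivs a b (f n)) \<longlonglongrightarrow> inward_derivs a b g"
    unfolding gammaD_def inward_derivs_def
    by (auto intro!: tendsto_vec_lambda tendsto_minus split: prod.split)
qed

text \<open>Simplicity compares function values only; the normal derivatives follow by uniqueness of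
  one-sided derivatives on the closed edge.\<close>

lemma graph_sol_deriv_eq:
  assumes f: "graph_sol \<mu> f f1" and h: "graph_sol \<nu> h h1"
    and eq: "\<And>x. x \<in> {a e..b e} \<Longrightarrow> f e x = c * h e x" and x: "x \<in> {a e..b e}"
  shows "f1 e x = c * h1 e x"
proof (rule vector_derivative_unique_within_closed_interval[OF edges[of e], unfolded cbox_interval, OF x])
  show "(f e has_vector_derivative f1 e x) (at x within {a e..b e})"
    by (rule sl_sol_deriv[OF graph_solD[OF f] x])
  have "((\<lambda>x. c * h e x) has_vector_derivative c * h1 e x) (at x within {a e..b e})"
    by (rule has_vector_derivative_mult_right[OF sl_sol_deriv[OF graph_solD[OF h] x]])
  then show "(f e has_vector_derivative c * h1 e x) (at x within {a e..b e})"
    by (rule has_vector_derivative_transform[OF x, rotated]) (simp add: eq)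
qed

lemma initial_data_scale:
  "initial_data a (\<lambda>e x. of_real r * f e x) (\<lambda>e x. of_real r * f1 e x) = r *\<^sub>R initial_data a f f1"
  by (simp add: initial_data_def vec_eq_iff scaleR_conv_of_real)

end

section \<open>Solutions subject to the moving boundary condition\<close>

locale quantum_graph = sl_graph a b Q C + lagrangian_path A B Ad Bd S
  for a b :: "'e::finite \<Rightarrow> real" and Q C
    and A B Ad Bd :: "real \<Rightarrow> complex ^ ('e \<times> bool) ^ ('e \<times> bool)" and S +
  fixes q :: "'e \<Rightarrow> real \<Rightarrow> real"
  assumes Q_measurable: "Q e \<in> borel_measurable borel"
    and q_eq_Q: "AE x in lborel. x \<in> {a e..b e} \<longrightarrow> q e x = Q e x"
begin

lemma solves_eq_iff: "solves_eq a b q \<mu> f \<longleftrightarrow> (\<exists>f1. graph_sol \<mu> f f1)"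
proof
  assume "solves_eq a b q \<mu> f"
  then have "\<exists>f1. sl_sol (a e) (b e) (\<lambda>x. Q e x - \<mu>) (f e) f1" for e
    unfolding solves_eq_def using H2_edge_imp_sl_sol[OF _ _ q_eq_Q[of e]] by blast
  then have "\<forall>e. \<exists>f1. sl_sol (a e) (b e) (\<lambda>x. Q e x - \<mu>) (f e) f1"
    by blast
  from choice[OF this] show "\<exists>f1. graph_sol \<mu> f f1"
    by (simp add: graph_sol_def)
next
  assume "\<exists>f1. graph_sol \<mu> f f1"
  then show "solves_eq a b q \<mu> f"
    unfolding solves_eq_def
    using sl_sol_imp_H2_edge[OF graph_solD Q_measurable Q_bound q_eq_Q] by blast
qed

lemma in_eigenspace_iff:
  "in_eigenspace a b q M N \<mu> f \<longleftrightarrow>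
    (\<exists>f1. graph_sol \<mu> f f1 \<and> M *v gammaD a b f + N *v inward_derivs a b f1 = 0)"
  unfolding in_eigenspace_def solves_eq_iff using gammaN_eq by metis

text \<open>A nonzero norm in L2 forces nonzero initial data, by uniqueness for the initial value
  problem, so the eigenfunction can be rescaled.\<close>

lemma normalized_eigenfunction:
  assumes "is_eigenvalue a b q M N \<mu>"
  shows "\<exists>f f1. graph_sol \<mu> f f1 \<and> M *v gammaD a b f + N *v inward_derivs a b f1 = 0
    \<and> norm (initial_data a f f1) = 1"
proof -
  obtain f f1 where f: "graph_sol \<mu> f f1" and bc: "M *v gammaD a b f + N *v inward_derivs a b f1 = 0"
      and nz: "L2norm_sq a b f \<noteq> 0"
    using assms unfolding is_eigenvalue_def eigenfunction_def in_eigenspace_iff by blast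
  define r where "r = norm (initial_data a f f1)"
  have "initial_data a f f1 \<noteq> 0"
  proof
    assume "initial_data a f f1 = 0"
    then have "f e x = 0" if "x \<in> {a e..b e}" for e x
      using zero_if_initial_data_zero[OF f _ that] by blast
    then have "(LINT x:{a e..b e}|lborel. (cmod (f e x))\<^sup>2) = (LINT x:{a e..b e}|lborel. 0)" for e
      by (intro set_lebesgue_integral_cong) auto
    then show False
      using nz by (simp add: L2norm_sq_def)
  qed
  then have r: "r > 0"
    by (simp add: r_def)
  let ?c = "complex_of_real (1 / r)"
  show ?thesis
  proof (intro exI conjI)
    show "graph_sol \<mu> (\<lambda>e x. ?c * f e x) (\<lambda>e x. ?c * f1 e x)"
      by (rule graph_sol_scale[OF f])
    have "M *v (?c *s gammaD a b f) + N *v (?c *s inward_derivs a b f1)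
        = ?c *s (M *v gammaD a b f + N *v inward_derivs a b f1)"
      by (simp only: vector_scalar_commute vector_add_ldistrib)
    then show "M *v gammaD a b (\<lambda>e x. ?c * f e x) + N *v inward_derivs a b (\<lambda>e x. ?c * f1 e x) = 0"
      unfolding traces_scale bc by simp
    show "norm (initial_data a (\<lambda>e x. ?c * f e x) (\<lambda>e x. ?c * f1 e x)) = 1"
      unfolding initial_data_scale using r by (simp add: r_def)
  qed
qed

lemma Tr_eq: "graph_sol \<mu> f f1 \<Longrightarrow> Tr a b f = (gammaD a b f, inward_derivs a b f1)"
  by (simp add: Tr_def gammaN_eq)

lemma difference_quotient_subsequence:
  fixes X :: "nat \<Rightarrow> real"
  assumes t0: "t0 \<in> S" and u: "graph_sol (lam t0) u u1" and u_norm: "L2norm_sq a b u = 1"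
    and u_frame: "Tr a b u = frame (A t0) (B t0) \<phi>"
    and simple: "\<And>f f1. graph_sol (lam t0) f f1 \<Longrightarrow>
      A t0 *v gammaD a b f + B t0 *v inward_derivs a b f1 = 0 \<Longrightarrow>
      \<exists>c. \<forall>e. \<forall>x\<in>{a e..b e}. f e x = c * u e x"
    and lam: "isCont lam t0"
    and X: "X \<longlonglongrightarrow> t0" "\<And>n. X n \<in> S" "\<And>n. X n \<noteq> t0"
    and inv: "\<And>n. invertible (mixed_gram t0 (X n))"
    and eig: "\<And>n. is_eigenvalue a b q (A (X n)) (B (X n)) (lam (X n))"
  shows "\<exists>r :: nat \<Rightarrow> nat. strict_mono r \<and>
    (\<lambda>n. complex_of_real ((lam (X (r n)) - lam t0) / (X (r n) - t0)))
      \<longlonglongrightarrow> cinner ((A t0 ** adj (Bd t0) - B t0 ** adj (Ad t0)) *v \<phi>) \<phi>"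
proof -
  have "\<forall>n. \<exists>p. graph_sol (lam (X n)) (fst p) (snd p) \<and>
      A (X n) *v gammaD a b (fst p) + B (X n) *v inward_derivs a b (snd p) = 0 \<and>
      norm (initial_data a (fst p) (snd p)) = 1"
    using normalized_eigenfunction[OF eig] by simp
  from choice[OF this] obtain p where p: "\<And>n. graph_sol (lam (X n)) (fst (p n)) (snd (p n))"
      "\<And>n. A (X n) *v gammaD a b (fst (p n)) + B (X n) *v inward_derivs a b (snd (p n)) = 0"
      "\<And>n. norm (initial_data a (fst (p n)) (snd (p n))) = 1"
    by blast
  have "(\<lambda>n. lam (X n)) \<longlonglongrightarrow> lam t0"
    by (rule isCont_tendsto_compose[OF lam X(1)])
  from graph_sol_compact[OF p(1) this p(3)]
  obtain r g g1 where r: "strict_mono (r :: nat \<Rightarrow> nat)" and g: "graph_sol (lam t0) g g1"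
      and g_norm: "norm (initial_data a g g1) = 1"
      and lim: "\<And>e. uniform_limit {a e..b e} (\<lambda>n. fst (p (r n)) e) (g e) sequentially"
      and lim1: "\<And>e. uniform_limit {a e..b e} (\<lambda>n. snd (p (r n)) e) (g1 e) sequentially"
    by blast
  define Y where "Y = (\<lambda>n. X (r n))"
  define f f1 where "f = (\<lambda>n. fst (p (r n)))" and "f1 = (\<lambda>n. snd (p (r n)))"
  have Y: "Y \<longlonglongrightarrow> t0" and Y_S: "Y n \<in> S" and Y_ne: "Y n \<noteq> t0"
      and inv_Y: "invertible (mixed_gram t0 (Y n))" for n
    using LIMSEQ_subseq_LIMSEQ[OF X(1) r] X(2,3) inv by (simp_all add: Y_def o_def)
  have f: "graph_sol (lam (Y n)) (f n) (f1 n)"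
      and f_bc: "A (Y n) *v gammaD a b (f n) + B (Y n) *v inward_derivs a b (f1 n) = 0" for n
    using p(1,2) by (simp_all add: f_def f1_def Y_def)
  have A_Y: "(\<lambda>n. A (Y n)) \<longlonglongrightarrow> A t0" and B_Y: "(\<lambda>n. B (Y n)) \<longlonglongrightarrow> B t0"
    by (auto intro: isCont_tendsto_compose[OF _ Y] simp: isCont_def A_tendsto B_tendsto t0)
  have D_lim: "(\<lambda>n. gammaD a b (f n)) \<longlonglongrightarrow> gammaD a b g"
      and N_lim: "(\<lambda>n. inward_derivs a b (f1 n)) \<longlonglongrightarrow> inward_derivs a b g1"
    unfolding f_def f1_def by (rule traces_tendsto[OF lim] traces_tendsto[OF lim1])+
  have "(\<lambda>n. A (Y n) *v gammaD a b (f n) + B (Y n) *v inward_derivs a b (f1 n))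
      \<longlonglongrightarrow> A t0 *v gammaD a b g + B t0 *v inward_derivs a b g1"
    by (intro tendsto_add tendsto_matrix_vector A_Y B_Y D_lim N_lim)
  \<comment> \<open>The boundary condition survives the limit, so \<open>g\<close> lies in the
    eigenspace at \<open>t0\<close> and simplicity applies.\<close>
  then have "A t0 *v gammaD a b g + B t0 *v inward_derivs a b g1 = 0"
    unfolding f_bc by (simp add: LIMSEQ_const_iff)
  from simple[OF g this] obtain c where gu: "\<And>e x. x \<in> {a e..b e} \<Longrightarrow> g e x = c * u e x"
    by blast
  have g1u1: "\<And>e x. x \<in> {a e..b e} \<Longrightarrow> g1 e x = c * u1 e x"
    by (rule graph_sol_deriv_eq[OF g u gu])
  have c: "c \<noteq> 0"
  proof
    assume "c = 0"
    then have "initial_data a g g1 = 0"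
      using gu g1u1 edges by (simp add: initial_data_def vec_eq_iff zero_prod_def less_imp_le)
    then show False
      using g_norm by simp
  qed
  have "gammaD a b g = c *s gammaD a b u" "inward_derivs a b g1 = c *s inward_derivs a b u1"
    using gu g1u1 edges by (auto simp: gammaD_def inward_derivs_def vec_eq_iff less_imp_le)
  then have Tr_g: "(gammaD a b g, inward_derivs a b g1) = pscale c (frame (A t0) (B t0) \<phi>)"
    by (simp add: pscale_def u_frame[symmetric] Tr_eq[OF u])

  \<comment> \<open>Reading the coordinates of \<open>Tr f\<close> through the fixed
    \<open>coframe\<close> at \<open>t0\<close> makes them a continuous function of the traces and
    of the parameter, so their limit can be computed.\<close>
  define M where "M = (\<lambda>n. matrix_inv (mixed_gram t0 (Y n)))"
  define h where "h = (\<lambda>n. M n *v coframe (A t0) (B t0) (Tr a b (f n)))"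
  have Tr_f: "Tr a b (f n) = frame (A (Y n)) (B (Y n)) (h n)" for n
  proof -
    have "Tr a b (f n) \<in> range (frame (A (Y n)) (B (Y n)))"
      using f_bc[of n] plane_eq[OF Y_S[of n]] by (auto simp: bc_plane_def Tr_eq[OF f])
    then have "Tr a b (f n) = lift t0 (Y n) (Tr a b (f n))"
      by (rule lift_unique[OF inv_Y]) simp
    then show ?thesis
      by (simp only: lift_def h_def M_def)
  qed
  have "h \<longlonglongrightarrow> matrix_inv (mixed_gram t0 t0) *v coframe (A t0) (B t0) (pscale c (frame (A t0) (B t0) \<phi>))"
  proof -
    have "(\<lambda>n. mixed_gram t0 (Y n)) \<longlonglongrightarrow> mixed_gram t0 t0"
      by (rule isCont_tendsto_compose[OF _ Y]) (simp add: isCont_def mixed_gram_tendsto t0)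
    then have M_lim: "M \<longlonglongrightarrow> matrix_inv (mixed_gram t0 t0)"
      unfolding M_def by (rule tendsto_matrix_inv[OF _ invertible_mixed_gram_self[OF t0]])
    show ?thesis
      unfolding h_def coframe_def Tr_eq[OF f] Tr_g[symmetric] fst_conv snd_conv
      by (intro tendsto_matrix_vector tendsto_diff M_lim tendsto_const D_lim N_lim)
  qed
  moreover have "matrix_inv (mixed_gram t0 t0) *v coframe (A t0) (B t0) (pscale c (frame (A t0) (B t0) \<phi>)) = c *s \<phi>"
    unfolding frame_scale[symmetric] coframe_frame mixed_gram_def[symmetric]
    by (rule matrix_inv_mult_vector[OF invertible_mixed_gram_self[OF t0]])
  ultimately have h: "h \<longlonglongrightarrow> c *s \<phi>"
    by simp

  \<comment> \<open>The matrix from Green's identity. It vanishes at \<open>t0\<close>, so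
    \<open>Z t\<close> divided by \<open>t - t0\<close> is itself the difference quotient.\<close>
  define Z where "Z = (\<lambda>t. A t ** adj (B t0) - B t ** adj (A t0))"
  have "(Z has_vector_derivative Ad t0 ** adj (B t0) - Bd t0 ** adj (A t0)) (at t0)"
    unfolding Z_def
    by (intro has_vector_derivative_diff
        bounded_linear.has_vector_derivative[OF bounded_bilinear.bounded_linear_left[OF bounded_bilinear_matrix_matrix]]
        A_deriv B_deriv t0)
  moreover have Z0: "Z t0 = 0"
    using symm[OF t0] by (simp add: Z_def)
  ultimately have Z_deriv: "((\<lambda>t. Z t /\<^sub>R (t - t0)) \<longlongrightarrow> Ad t0 ** adj (B t0) - Bd t0 ** adj (A t0)) (at t0)"
    by (simp add: has_vector_derivative_iff_tendsto)
  have "filterlim Y (at t0) sequentially"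
    using Y Y_ne by (auto simp: filterlim_at)
  from filterlim_compose[OF Z_deriv this]
  have Z_lim: "(\<lambda>n. Z (Y n) /\<^sub>R (Y n - t0)) \<longlonglongrightarrow> Ad t0 ** adj (B t0) - Bd t0 ** adj (A t0)" .

  define I where "I = (\<lambda>n. edge_inner a b u (f n))"
  have "I \<longlonglongrightarrow> edge_inner a b u g"
    unfolding I_def f_def
    by (rule edge_inner_tendsto[OF sl_sol_continuous[OF graph_solD[OF u]]
          sl_sol_continuous[OF graph_solD[OF p(1)]] lim])
  also have "edge_inner a b u g = (\<Sum>e\<in>UNIV. integral {a e..b e} (\<lambda>x. cnj c * (u e x * cnj (u e x))))"
    unfolding edge_inner_def using gu
    by (intro sum.cong integral_cong) (auto simp: mult_ac)
  also have "\<dots> = cnj c * edge_inner a b u u"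
    by (simp add: edge_inner_def sum_distrib_left)
  also have "\<dots> = cnj c"
    using edge_inner_self[OF sl_sol_continuous[OF graph_solD[OF u]]] u_norm by simp
  finally have I: "I \<longlonglongrightarrow> cnj c" .

  have quot: "complex_of_real ((lam (Y n) - lam t0) / (Y n - t0)) * I n
      = - cinner ((Z (Y n) /\<^sub>R (Y n - t0)) *v \<phi>) (h n)" for n
  proof -
    have "of_real (lam t0 - lam (Y n)) * I n = cinner (Z (Y n) *v \<phi>) (h n)"
      using green_identity[OF u f[of n]] unfolding u_frame Tr_f omega_frame Z_def I_def by simp
    then have "of_real ((lam (Y n) - lam t0) / (Y n - t0)) * I n
        = - (cinner (Z (Y n) *v \<phi>) (h n) / of_real (Y n - t0))"
      by (simp add: field_simps)
    also have "cinner (Z (Y n) *v \<phi>) (h n) / of_real (Y n - t0)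
        = cinner ((Z (Y n) /\<^sub>R (Y n - t0)) *v \<phi>) (h n)"
      unfolding bounded_bilinear.scaleR_left[OF bounded_bilinear_matrix_vector]
        bounded_bilinear.scaleR_left[OF bounded_bilinear_cinner]
      by (simp add: scaleR_conv_of_real divide_inverse)
    finally show ?thesis .
  qed
  \<comment> \<open>\<open>c\<close> enters numerator and denominator through the conjugate-linear
    slot both times, so the same factor \<open>cnj c\<close> cancels.\<close>
  have "(\<lambda>n. - cinner ((Z (Y n) /\<^sub>R (Y n - t0)) *v \<phi>) (h n) / I n)
      \<longlonglongrightarrow> - cinner ((Ad t0 ** adj (B t0) - Bd t0 ** adj (A t0)) *v \<phi>) (c *s \<phi>) / cnj c"
    using c
    by (intro tendsto_divide tendsto_minus bounded_bilinear.tendsto[OF bounded_bilinear_cinner]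
        tendsto_matrix_vector Z_lim h I tendsto_const) simp
  moreover have "\<forall>\<^sub>F n in sequentially. I n \<noteq> 0"
    using tendsto_imp_eventually_ne[OF I] c by simp
  then have "\<forall>\<^sub>F n in sequentially. - cinner ((Z (Y n) /\<^sub>R (Y n - t0)) *v \<phi>) (h n) / I n
      = complex_of_real ((lam (Y n) - lam t0) / (Y n - t0))"
    by eventually_elim (simp add: quot[symmetric] del: of_real_divide of_real_diff)
  ultimately have "(\<lambda>n. complex_of_real ((lam (Y n) - lam t0) / (Y n - t0)))
      \<longlonglongrightarrow> - cinner ((Ad t0 ** adj (B t0) - Bd t0 ** adj (A t0)) *v \<phi>) (c *s \<phi>) / cnj c"
    by (rule Lim_transform_eventually)
  also have "- cinner ((Ad t0 ** adj (B t0) - Bd t0 ** adj (A t0)) *v \<phi>) (c *s \<phi>) / cnj c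
      = - cinner ((Ad t0 ** adj (B t0) - Bd t0 ** adj (A t0)) *v \<phi>) \<phi>"
    using c by (simp add: cinner_scale_right)
  also have "\<dots> = cinner ((A t0 ** adj (Bd t0) - B t0 ** adj (Ad t0)) *v \<phi>) \<phi>"
  proof -
    have "Ad t0 ** adj (B t0) - Bd t0 ** adj (A t0) = - (A t0 ** adj (Bd t0) - B t0 ** adj (Ad t0))"
      using deriv_symm[OF t0] by (simp add: algebra_simps)
    then show ?thesis
      by (simp only: bounded_bilinear.minus_left[OF bounded_bilinear_matrix_vector] cinner_minus_left minus_minus)
  qed
  finally show ?thesis
    using r unfolding Y_def by blast
qed

end

theorem theorem3p4:
  fixes a b :: "'e::finite \<Rightarrow> real"
    and q :: "'e \<Rightarrow> real \<Rightarrow> real"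
    and A B Ad Bd :: "real \<Rightarrow> complex ^ ('e \<times> bool) ^ ('e \<times> bool)"
    and \<alpha> \<beta> t0 lam0 :: real
    and lam :: "real \<Rightarrow> real"
    and u :: "'e \<Rightarrow> real \<Rightarrow> complex"
  assumes edges: "\<And>e. a e < b e"
    and q_meas: "\<And>e. set_borel_measurable lborel {a e..b e} (q e)"
    and q_bdd: "\<And>e. \<exists>C. AE x in lborel. x \<in> {a e..b e} \<longrightarrow> \<bar>q e x\<bar> \<le> C"
    and A_C1: "\<And>t. t \<in> {\<alpha>..\<beta>} \<Longrightarrow> (A has_vector_derivative Ad t) (at t within {\<alpha>..\<beta>})"
    and B_C1: "\<And>t. t \<in> {\<alpha>..\<beta>} \<Longrightarrow> (B has_vector_derivative Bd t) (at t within {\<alpha>..\<beta>})"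
    and Ad_cont: "continuous_on {\<alpha>..\<beta>} Ad"
    and Bd_cont: "continuous_on {\<alpha>..\<beta>} Bd"
    and rank_AB: "\<And>t. t \<in> {\<alpha>..\<beta>} \<Longrightarrow> rank (hcat (A t) (B t)) = CARD('e \<times> bool)"
    and sym_AB: "\<And>t. t \<in> {\<alpha>..\<beta>} \<Longrightarrow> A t ** adj (B t) = B t ** adj (A t)"
    and t0: "t0 \<in> {\<alpha><..<\<beta>}"
    and simple: "simple_eigenvalue a b q (A t0) (B t0) lam0"
    and u_eig: "eigenfunction a b q (A t0) (B t0) lam0 u"
    and u_norm: "L2norm_sq a b u = 1"
    and curve: "\<forall>\<^sub>F t in nhds t0. is_eigenvalue a b q (A t) (B t) (lam t)"
    and curve_cont: "isCont lam t0"
    and curve_t0: "lam t0 = lam0"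
    and inv: "invertible (A t0 ** adj (A t0) - B t0 ** adj (B t0))"
  shows "\<exists>D. (lam has_real_derivative D) (at t0) \<and>
     (let \<phi> = matrix_inv (A t0 ** adj (A t0) - B t0 ** adj (B t0))
                *v (B t0 *v gammaD a b u + A t0 *v gammaN a b u)
      in complex_of_real D = cinner ((A t0 ** adj (Bd t0) - B t0 ** adj (Ad t0)) *v \<phi>) \<phi>
         \<and> cinner ((A t0 ** adj (Bd t0) - B t0 ** adj (Ad t0)) *v \<phi>) \<phi>
           = crossing_form (Kset a b q lam0) (\<lambda>t. bc_plane (A t) (B t)) t0 (Tr a b u))"
proof -
  have "\<exists>Q C. Q \<in> borel_measurable borel \<and> (\<forall>x. \<bar>Q x\<bar> \<le> C) \<and>
      (AE x in lborel. x \<in> {a e..b e} \<longrightarrow> q e x = Q x)" for e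
    by (rule bounded_representative[OF q_meas q_bdd]) blast
  then have "\<forall>e. \<exists>p :: (real \<Rightarrow> real) \<times> real. fst p \<in> borel_measurable borel \<and> (\<forall>x. \<bar>fst p x\<bar> \<le> snd p) \<and>
      (AE x in lborel. x \<in> {a e..b e} \<longrightarrow> q e x = fst p x)"
    by simp
  from choice[OF this] obtain p :: "'e \<Rightarrow> (real \<Rightarrow> real) \<times> real"
    where p: "\<And>e. fst (p e) \<in> borel_measurable borel" "\<And>e x. \<bar>fst (p e) x\<bar> \<le> snd (p e)"
      "\<And>e. AE x in lborel. x \<in> {a e..b e} \<longrightarrow> q e x = fst (p e) x"
    by blast
  let ?S = "{\<alpha><..<\<beta>}"
  have at: "at t within {\<alpha>..\<beta>} = at t" if "t \<in> ?S" for t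
    using that by (intro at_within_interior) simp
  interpret quantum_graph a b "\<lambda>e. fst (p e)" "\<lambda>e. snd (p e)" A B Ad Bd ?S q
  proof unfold_locales
    show "(A has_vector_derivative Ad t) (at t)" "(B has_vector_derivative Bd t) (at t)"
      "rank (hcat (A t) (B t)) = CARD('e \<times> bool)" "A t ** adj (B t) = B t ** adj (A t)" if "t \<in> ?S" for t
      using A_C1[of t] B_C1[of t] rank_AB[of t] sym_AB[of t] that at[OF that] by auto
    show "continuous_on ?S Ad" "continuous_on ?S Bd"
      by (rule continuous_on_subset[OF Ad_cont] continuous_on_subset[OF Bd_cont], force)+
  qed (use edges p in auto)

  define X where "X = A t0 ** adj (Bd t0) - B t0 ** adj (Ad t0)"
  obtain u1 where u1: "graph_sol (lam t0) u u1"
    using u_eig unfolding eigenfunction_def in_eigenspace_iff curve_t0 by blast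
  have "Tr a b u \<in> bc_plane (A t0) (B t0)"
    using u_eig by (simp add: eigenfunction_def in_eigenspace_def bc_plane_def Tr_def)
  then obtain \<phi> where u_frame: "Tr a b u = frame (A t0) (B t0) \<phi>"
    unfolding plane_eq[OF t0] by blast
  \<comment> \<open>Inserting the frame form of \<open>Tr u\<close> shows that the vector defined by
    the inverse in the statement is the frame coordinate of \<open>Tr u\<close>.\<close>
  have "B t0 *v gammaD a b u + A t0 *v gammaN a b u
      = (A t0 ** adj (A t0) - B t0 ** adj (B t0)) *v \<phi>"
    using u_frame
    by (simp add: Tr_def frame_def matrix_vector_mult_minus matrix_vector_mult_diff_rdistrib
        flip: matrix_vector_mul_assoc)
  then have \<phi>: "matrix_inv (A t0 ** adj (A t0) - B t0 ** adj (B t0))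
      *v (B t0 *v gammaD a b u + A t0 *v gammaN a b u) = \<phi>"
    using matrix_inv_mult_vector(2)[OF inv] by simp

  \<comment> \<open>The reference eigenfunction \<open>w\<close> in the definition of simplicity
    need not be \<open>u\<close>; since \<open>u\<close> has norm 1 it is a nonzero multiple of
    \<open>w\<close>, and can replace it.\<close>
  have simple': "\<exists>c. \<forall>e. \<forall>x\<in>{a e..b e}. f e x = c * u e x"
    if f: "graph_sol (lam t0) f f1" "A t0 *v gammaD a b f + B t0 *v inward_derivs a b f1 = 0" for f f1
  proof -
    obtain w where w: "\<And>h. in_eigenspace a b q (A t0) (B t0) (lam t0) h \<Longrightarrow>
        \<exists>c. \<forall>e. \<forall>x\<in>{a e..b e}. h e x = c * w e x"
      using simple unfolding simple_eigenvalue_def curve_t0 by blast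
    obtain c where c: "\<And>e x. x \<in> {a e..b e} \<Longrightarrow> f e x = c * w e x"
      using w[of f] f unfolding in_eigenspace_iff by blast
    obtain d where d: "\<And>e x. x \<in> {a e..b e} \<Longrightarrow> u e x = d * w e x"
      using w[of u] u_eig unfolding eigenfunction_def curve_t0 by blast
    have "d \<noteq> 0"
    proof
      assume "d = 0"
      then have "(LINT x:{a e..b e}|lborel. (cmod (u e x))\<^sup>2) = (LINT x:{a e..b e}|lborel. 0)" for e
        using d by (intro set_lebesgue_integral_cong) auto
      then show False
        using u_norm by (simp add: L2norm_sq_def)
    qed
    then have "\<forall>e. \<forall>x\<in>{a e..b e}. f e x = c / d * u e x"
      using c d by simp
    then show ?thesis
      by blast
  qed

  \<comment> \<open>The subsequence lemma asks for invertibility and an eigenvalue at every index,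
    not just eventually, so the sequences are confined to a ball where both hold.\<close>
  obtain \<epsilon>1 where \<epsilon>1: "\<epsilon>1 > 0" "ball t0 \<epsilon>1 \<subseteq> ?S"
      and inv_gram: "\<And>t. t \<in> ball t0 \<epsilon>1 \<Longrightarrow> invertible (mixed_gram t0 t)"
    using invertible_mixed_gram_near[OF t0] by blast
  obtain \<epsilon>2 where \<epsilon>2: "\<epsilon>2 > 0"
      and eig: "\<And>t. t \<in> ball t0 \<epsilon>2 \<Longrightarrow> is_eigenvalue a b q (A t) (B t) (lam t)"
    using curve by (auto simp: eventually_nhds_metric dist_commute)
  define U where "U = ball t0 (min \<epsilon>1 \<epsilon>2)"
  have U: "t0 \<in> U" "open U" and U_sub: "U \<subseteq> ball t0 \<epsilon>1" "U \<subseteq> ball t0 \<epsilon>2"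
    using \<epsilon>1 \<epsilon>2 by (auto simp: U_def)
  have "((\<lambda>t. complex_of_real ((lam t - lam t0) / (t - t0))) \<longlongrightarrow> cinner (X *v \<phi>) \<phi>) (at t0 within U)"
    unfolding tendsto_at_iff_sequentially
  proof (intro allI impI)
    fix x :: "nat \<Rightarrow> real"
    assume x: "\<forall>i. x i \<in> U - {t0}" and x_lim: "x \<longlonglongrightarrow> t0"
    show "((\<lambda>t. complex_of_real ((lam t - lam t0) / (t - t0))) \<circ> x) \<longlonglongrightarrow> cinner (X *v \<phi>) \<phi>"
    proof (rule tendsto_if_subsequences_tendsto)
      fix r :: "nat \<Rightarrow> nat" assume r: "strict_mono r"
      have xr: "x (r n) \<in> U" "x (r n) \<noteq> t0" for n
        using x[rule_format, of "r n"] by blast+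
      have "\<exists>s :: nat \<Rightarrow> nat. strict_mono s \<and>
          (\<lambda>n. complex_of_real ((lam (x (r (s n))) - lam t0) / (x (r (s n)) - t0)))
            \<longlonglongrightarrow> cinner ((A t0 ** adj (Bd t0) - B t0 ** adj (Ad t0)) *v \<phi>) \<phi>"
      proof (rule difference_quotient_subsequence[where lam = lam and X = "\<lambda>n. x (r n)",
            OF t0 u1 u_norm u_frame simple' curve_cont])
        show "(\<lambda>n. x (r n)) \<longlonglongrightarrow> t0"
          using LIMSEQ_subseq_LIMSEQ[OF x_lim r] by (simp add: o_def)
        show "x (r n) \<in> ?S" for n
          by (rule subsetD[OF \<epsilon>1(2) subsetD[OF U_sub(1) xr(1)]])
        show "x (r n) \<noteq> t0" for n
          by (rule xr(2))
        show "invertible (mixed_gram t0 (x (r n)))" for n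
          by (rule inv_gram[OF subsetD[OF U_sub(1) xr(1)]])
        show "is_eigenvalue a b q (A (x (r n))) (B (x (r n))) (lam (x (r n)))" for n
          by (rule eig[OF subsetD[OF U_sub(2) xr(1)]])
      qed
      then show "\<exists>s :: nat \<Rightarrow> nat. strict_mono s \<and>
          (\<lambda>n. ((\<lambda>t. complex_of_real ((lam t - lam t0) / (t - t0))) \<circ> x) (r (s n))) \<longlonglongrightarrow> cinner (X *v \<phi>) \<phi>"
        by (simp only: o_def X_def)
    qed
  qed
  then have lim: "((\<lambda>t. complex_of_real ((lam t - lam t0) / (t - t0))) \<longlongrightarrow> cinner (X *v \<phi>) \<phi>) (at t0)"
    unfolding at_within_open[OF U] .
  from tendsto_Re[OF lim] have "(lam has_real_derivative Re (cinner (X *v \<phi>) \<phi>)) (at t0)"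
    by (simp add: has_field_derivative_iff)
  \<comment> \<open>All quotients are real, so the imaginary part of their limit is zero.\<close>
  moreover have "complex_of_real (Re (cinner (X *v \<phi>) \<phi>)) = cinner (X *v \<phi>) \<phi>"
    using tendsto_Im[OF lim] by (simp add: complex_eq_iff tendsto_const_iff)
  moreover have "cinner (X *v \<phi>) \<phi>
      = crossing_form (Kset a b q lam0) (\<lambda>t. bc_plane (A t) (B t)) t0 (Tr a b u)"
  proof -
    have "Tr a b u \<in> Kset a b q lam0"
      using u_eig by (auto simp: Kset_def eigenfunction_def in_eigenspace_def)
    then show ?thesis
      unfolding u_frame X_def by (rule crossing_form_frame[OF t0, symmetric])
  qed
  ultimately show ?thesis
    unfolding \<phi> X_def[symmetric] Let_def by blast
qed

end
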